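(* Let $\varphi$ have $L$-Lipschitz-continuous gradient w.r.t. the 2-norm and $\|\lambda^*\|_2\le R$, where $\lambda^*$ is a solution of the dual problem $(D)$. Given desired accuracy $\varepsilon>0$, assume that at each iteration of the Accelerated Primal-Dual Stochastic Gradient Method (APDSGM, described in the context) the stochastic gradient $\nabla\Phi(\lambda_k,\xi_k)$ is chosen in such a way that $\mathbb{E}_\xi\|\nabla\Phi(\lambda_k,\xi_k)-\nabla\varphi(\lambda_k)\|_2^2\le\frac{\varepsilon L\alpha_k}{C_k}$. Then, for any $\varepsilon>0$ and $N\ge1$, with expectation $\mathbb{E}$ w.r.t. all the randomness $\xi_1,\dots,\xi_N$, the outputs $\eta_N$ and $\hat x_N$ of the method satisfy $$f(\mathbb{E}\hat x_N)-f^*\le\frac{32LR^2}{N^2}+\frac\varepsilon2\quad\text{and}\quad\|A\mathbb{E}\hat x_N-b\|_2\le\frac{32LR}{N^2}+\frac\varepsilon{2R}.$$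
   Context: Primal-dual pair: $(P)$ $\min_{x\in Q\subseteq E}\{f(x):Ax=b\}$, and $(D)$ $\min_{\lambda\in\Lambda}\varphi(\lambda)$, $\varphi(\lambda)=\langle\lambda,b\rangle+\max_{x\in Q}(-f(x)-\langle A^T\lambda,x\rangle)=\langle\lambda,b\rangle+f^*(-A^T\lambda)$, where $E,H$ are finite-dimensional real vector spaces, $Q$ is a simple closed convex set, $f$ is convex, $A:E\to H$ is linear, $b\in H$, $\Lambda=H^*$, and $f^*(\cdot)$ is the Fenchel–Legendre conjugate of $f$ on $Q$. In the claim, $f^*$ (without argument) is the optimal value of $(P)$. $(D)$ is assumed to have a solution. Stochastic structure: $f^*(-A^T\lambda)=\mathbb{E}_\xi F^*(-A^T\lambda,\xi)$, $\xi$ a random vector; $F(x,\xi)$ is the Fenchel–Legendre conjugate of $F^*$, i.e. $F^*(-A^T\lambda,\xi)=\max_{x\in Q}\{\langle-A^T\lambda,x\rangle-F(x,\xi)\}$, and $x(\lambda,\xi)$ is the solution of this maximization problem. The stochastic oracle is $\Phi(\lambda,\xi)=\langle\lambda,b\rangle+F^*(-A^T\lambda,\xi)$ with $\nabla\Phi(\lambda,\xi)=b-Ax(\lambda,\xi)$, satisfying $\mathbb{E}_\xi\Phi(\lambda,\xi)=\varphi(\lambda)$, $\mathbb{E}_\xi\nabla\Phi(\lambda,\xi)=\nabla\varphi(\lambda)$. The variance of $\nabla\Phi$ can be controlled (e.g. by mini-batching). APDSGM with $N$ iterations: $C_0=\alpha_0=0$, $\eta_0=\zeta_0=\lambda_0=0$.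 For $k=0,\dots,N-1$: $\alpha_{k+1}$ is the largest root of $C_{k+1}:=C_k+\alpha_{k+1}=2L\alpha_{k+1}^2$; $\tau_{k+1}=\alpha_{k+1}/C_{k+1}$; $\lambda_{k+1}=\tau_{k+1}\zeta_k+(1-\tau_{k+1})\eta_k$; $\zeta_{k+1}=\zeta_k-\alpha_{k+1}\nabla\Phi(\lambda_{k+1},\xi_{k+1})$, with a fresh realization $\xi_{k+1}$; $\eta_{k+1}=\tau_{k+1}\zeta_{k+1}+(1-\tau_{k+1})\eta_k$; $\hat x_{k+1}=\tau_{k+1}x(\lambda_{k+1},\xi_{k+1})+(1-\tau_{k+1})\hat x_k$. Output $\hat x_N,\eta_N$.
   Formalization: The identity f*(s) = E F*(s,ξ) is assumed for every s, not only for s = −Aᵀλ (with the latter alone the claim is false), and f is assumed closed on Q (automatic when f is finite and convex on all of E). *)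

theory Defs
  imports "HOL-Probability.Probability"
begin

text \<open>
  The spaces \<open>E\<close> and \<open>H\<close> are Euclidean spaces; \<open>E\<^sup>*\<close> and \<open>H\<^sup>*\<close> are identified with
  \<open>E\<close> and \<open>H\<close> through the inner product, so that \<open>A\<^sup>T\<close> is \<open>adjoint A\<close> and \<open>norm\<close>
  is the 2-norm.
\<close>

text \<open>
  Fenchel--Legendre conjugate relative to a set: the supremum is taken in the extended reals, since
  \<open>f\<^sup>*(s)\<close> may be infinite for \<open>s\<close> outside the range of \<open>A\<^sup>T\<close>.
\<close>

definition fenchel_conjugate :: "'e::euclidean_space set \<Rightarrow> ('e \<Rightarrow> ereal) \<Rightarrow> 'e \<Rightarrow> ereal" where
  "fenchel_conjugate S g s = (SUP x\<in>S. ereal (s \<bullet> x) - g x)"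

text \<open>
  Expectation of an extended-real function as the difference of the integrals of its positive and
  negative parts (\<open>e2ennreal\<close> truncates negative values to \<open>0\<close>); the value is \<open>\<infinity>\<close>
  whenever the positive part has infinite integral, as \<open>\<infinity> - \<infinity> = \<infinity>\<close> in \<open>ereal\<close>.
  If the value is finite and the function is measurable, it is integrable.
\<close>

definition ereal_expectation :: "'w measure \<Rightarrow> ('w \<Rightarrow> ereal) \<Rightarrow> ereal" where
  "ereal_expectation M g =
     enn2ereal (\<integral>\<^sup>+ w. e2ennreal (g w) \<partial>M) - enn2ereal (\<integral>\<^sup>+ w. e2ennreal (- g w) \<partial>M)"

definition primal_value ::
    "'e::euclidean_space set \<Rightarrow> ('e \<Rightarrow> real) \<Rightarrow> ('e \<Rightarrow> 'h::euclidean_space) \<Rightarrow> 'h \<Rightarrow> real" where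
  "primal_value Q f A b = (INF x\<in>{x\<in>Q. A x = b}. f x)"

definition dual_objective ::
    "'e::euclidean_space set \<Rightarrow> ('e \<Rightarrow> real) \<Rightarrow> ('e \<Rightarrow> 'h::euclidean_space) \<Rightarrow> 'h \<Rightarrow> 'h \<Rightarrow> real" where
  "dual_objective Q f A b l =
     l \<bullet> b + real_of_ereal (fenchel_conjugate Q (\<lambda>x. ereal (f x)) (- adjoint A l))"

text \<open>
  \<open>Fstar s y\<close> is \<open>F\<^sup>*(s, y)\<close> for a realization \<open>y\<close> of \<open>\<xi>\<close>.  A realization may be a whole
  mini-batch, in which case \<open>Fstar s y\<close> is the average over the batch.
\<close>

definition sample_primal :: "('e::euclidean_space \<Rightarrow> 'x \<Rightarrow> ereal) \<Rightarrow> 'e \<Rightarrow> 'x \<Rightarrow> ereal" where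
  "sample_primal Fstar x y = fenchel_conjugate UNIV (\<lambda>s. Fstar s y) x"

definition stoch_dual ::
    "('e::euclidean_space \<Rightarrow> 'x \<Rightarrow> ereal) \<Rightarrow> ('e \<Rightarrow> 'h::euclidean_space) \<Rightarrow> 'h \<Rightarrow> 'h \<Rightarrow> 'x \<Rightarrow> real" where
  "stoch_dual Fstar A b l y = l \<bullet> b + real_of_ereal (Fstar (- adjoint A l) y)"

definition stoch_grad ::
    "('h::euclidean_space \<Rightarrow> 'x \<Rightarrow> 'e::euclidean_space) \<Rightarrow> ('e \<Rightarrow> 'h) \<Rightarrow> 'h \<Rightarrow> 'h \<Rightarrow> 'x \<Rightarrow> 'h" where
  "stoch_grad xsol A b l y = b - A (xsol l y)"

definition largest_root :: "real \<Rightarrow> real \<Rightarrow> real" where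
  "largest_root L c = (GREATEST a. c + a = 2 * L * a\<^sup>2)"

primrec apd_C :: "real \<Rightarrow> nat \<Rightarrow> real" where
  "apd_C L 0 = 0"
| "apd_C L (Suc k) = apd_C L k + largest_root L (apd_C L k)"

primrec apd_alpha :: "real \<Rightarrow> nat \<Rightarrow> real" where
  "apd_alpha L 0 = 0"
| "apd_alpha L (Suc k) = largest_root L (apd_C L k)"

definition apd_tau :: "real \<Rightarrow> nat \<Rightarrow> real" where
  "apd_tau L k = apd_alpha L k / apd_C L k"

text \<open>
  One run of the method along the realizations \<open>y 1, y 2, \<dots>\<close>; the state after \<open>k\<close> steps is
  \<open>(\<lambda>\<^sub>k, \<zeta>\<^sub>k, \<eta>\<^sub>k, xhat\<^sub>k)\<close>.  The value \<open>x0\<close> of \<open>xhat\<^sub>0\<close> is immaterial because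
  \<open>\<tau>\<^sub>1 = 1\<close>.
\<close>

primrec apdsgm ::
    "real \<Rightarrow> ('h::euclidean_space \<Rightarrow> 'x \<Rightarrow> 'e::euclidean_space) \<Rightarrow> ('e \<Rightarrow> 'h) \<Rightarrow> 'h \<Rightarrow> 'e \<Rightarrow>
     (nat \<Rightarrow> 'x) \<Rightarrow> nat \<Rightarrow> 'h \<times> 'h \<times> 'h \<times> 'e" where
  "apdsgm L xsol A b x0 y 0 = (0, 0, 0, x0)"
| "apdsgm L xsol A b x0 y (Suc k) =
     (let (_, zeta, eta, xhat) = apdsgm L xsol A b x0 y k;
          tau = apd_tau L (Suc k);
          lam' = tau *\<^sub>R zeta + (1 - tau) *\<^sub>R eta;
          zeta' = zeta - apd_alpha L (Suc k) *\<^sub>R stoch_grad xsol A b lam' (y (Suc k));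
          eta' = tau *\<^sub>R zeta' + (1 - tau) *\<^sub>R eta;
          xhat' = tau *\<^sub>R xsol lam' (y (Suc k)) + (1 - tau) *\<^sub>R xhat
      in (lam', zeta', eta', xhat'))"

definition apd_lambda ::
    "real \<Rightarrow> ('h::euclidean_space \<Rightarrow> 'x \<Rightarrow> 'e::euclidean_space) \<Rightarrow> ('e \<Rightarrow> 'h) \<Rightarrow> 'h \<Rightarrow> 'e \<Rightarrow>
     (nat \<Rightarrow> 'x) \<Rightarrow> nat \<Rightarrow> 'h" where
  "apd_lambda L xsol A b x0 y k = fst (apdsgm L xsol A b x0 y k)"

definition apd_xhat ::
    "real \<Rightarrow> ('h::euclidean_space \<Rightarrow> 'x \<Rightarrow> 'e::euclidean_space) \<Rightarrow> ('e \<Rightarrow> 'h) \<Rightarrow> 'h \<Rightarrow> 'e \<Rightarrow>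
     (nat \<Rightarrow> 'x) \<Rightarrow> nat \<Rightarrow> 'e" where
  "apd_xhat L xsol A b x0 y k = snd (snd (snd (apdsgm L xsol A b x0 y k)))"

end

theory Submission
  imports Defs
begin

text \<open>
  Along every run, the accelerated estimate sequence bounds \<open>C\<^sub>N \<phi>(\<eta>\<^sub>N)\<close> by the weighted sum of the
  linear models \<open>\<phi>(\<lambda>\<^sub>k) + \<nabla>\<Phi>(\<lambda>\<^sub>k, \<xi>\<^sub>k) \<bullet> (u - \<lambda>\<^sub>k)\<close>, plus \<open>\<parallel>u\<parallel>\<^sup>2 / 2\<close>, plus noise: a part that is
  linear in the gradient error and has mean zero because \<open>\<xi>\<^sub>k\<close> is independent of the past, and a
  quadratic part whose mean is at most \<open>\<epsilon> C\<^sub>N / 2\<close> by the variance assumption.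

  On the primal side \<open>x(\<lambda>, \<xi>)\<close> is a subgradient of \<open>F\<^sup>*(\<cdot>, \<xi>)\<close> at \<open>-A\<^sup>T \<lambda>\<close>. Hence for every \<open>s\<close> with
  \<open>f\<^sup>*(s)\<close> finite the mean of the linear models is at most
  \<open>C\<^sub>N (f\<^sup>*(s) - s \<bullet> z + (b - A z) \<bullet> u)\<close>, where \<open>z\<close> is the mean of the primal output.
  Infimizing over \<open>s\<close> turns \<open>f\<^sup>*(s) - s \<bullet> z\<close> into \<open>-f(z)\<close>; no interchange of this infimum with the
  expectation is needed because \<open>s\<close> is deterministic. The result is
  \<open>f(z) + \<phi>(\<lambda>\<^sup>*) \<le> (b - A z) \<bullet> u + \<parallel>u\<parallel>\<^sup>2 / (2 C\<^sub>N) + \<epsilon> / 2\<close> for all \<open>u\<close>, with \<open>C\<^sub>N \<ge> N\<^sup>2 / (8 L)\<close>.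
  Weak duality and \<open>u = 0\<close> give the objective bound; \<open>u = 2 R (A z - b) / \<parallel>A z - b\<parallel>\<close> together with
  \<open>f(z) + \<phi>(\<lambda>\<^sup>*) \<ge> -R \<parallel>A z - b\<parallel>\<close> gives the feasibility bound.
\<close>

section \<open>Step sizes and iterates\<close>

text \<open>Completing the square turns the root condition into
  \<open>(4 * L * a - 1)\<^sup>2 = 1 + 8 * L * c\<close>, so the greatest root is the one with the
  plus sign.\<close>

lemma largest_root_eq:
  assumes "L > 0" "c \<ge> 0"
  shows "largest_root L c = (1 + sqrt (1 + 8 * L * c)) / (4 * L)"
proof -
  define s where "s = sqrt (1 + 8 * L * c)"
  have s: "s\<^sup>2 = 1 + 8 * L * c" "s \<ge> 1"
    using assms by (auto simp: s_def)
  have "(GREATEST a. c + a = 2 * L * a\<^sup>2) = (1 + s) / (4 * L)"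
  proof (rule Greatest_equality)
    have "8 * L * (c + (1 + s) / (4 * L)) = 8 * L * (2 * L * ((1 + s) / (4 * L))\<^sup>2)"
      using assms s(1) by (simp add: field_simps power2_eq_square)
    then show "c + (1 + s) / (4 * L) = 2 * L * ((1 + s) / (4 * L))\<^sup>2"
      using assms(1) by (simp only: mult_cancel_left) simp
  next
    fix y assume y: "c + y = 2 * L * y\<^sup>2"
    have "(4 * L * y - 1)\<^sup>2 = 8 * L * (2 * L * y\<^sup>2) - 8 * L * y + 1"
      by (simp add: power2_eq_square algebra_simps)
    also have "\<dots> = s\<^sup>2"
      unfolding s(1) y[symmetric] by (simp add: algebra_simps)
    finally have "(4 * L * y - 1)\<^sup>2 \<le> s\<^sup>2"
      by (rule eq_refl)
    then have "4 * L * y - 1 \<le> s"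
      by (rule power2_le_imp_le) (rule order.trans[OF zero_le_one s(2)])
    then show "y \<le> (1 + s) / (4 * L)"
      using assms by (simp add: field_simps)
  qed
  then show ?thesis
    by (simp add: largest_root_def s_def)
qed

lemma largest_root_pos: "L > 0 \<Longrightarrow> c \<ge> 0 \<Longrightarrow> largest_root L c > 0"
  by (simp add: largest_root_eq add_pos_nonneg)

lemma largest_root_root:
  assumes "L > 0" "c \<ge> 0"
  shows "c + largest_root L c = 2 * L * (largest_root L c)\<^sup>2"
proof -
  have "(sqrt (1 + 8 * L * c))\<^sup>2 = 1 + 8 * L * c"
    using assms by simp
  then have "8 * L * (c + largest_root L c) = 8 * L * (2 * L * (largest_root L c)\<^sup>2)"
    using assms by (simp add: largest_root_eq field_simps power2_eq_square)
  then show ?thesis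
    using assms by simp
qed

lemma apd_C_nonneg: "L > 0 \<Longrightarrow> apd_C L k \<ge> 0"
  by (induction k) (auto simp: less_imp_le[OF largest_root_pos])

lemma apd_C_Suc: "apd_C L (Suc k) = apd_C L k + apd_alpha L (Suc k)"
  by simp

lemma apd_alpha_pos: "L > 0 \<Longrightarrow> apd_alpha L (Suc k) > 0"
  by (simp add: largest_root_pos apd_C_nonneg)

lemma apd_C_pos: "L > 0 \<Longrightarrow> apd_C L (Suc k) > 0"
  unfolding apd_C_Suc using apd_alpha_pos[of L k] apd_C_nonneg[of L k] by linarith

lemma apd_C_eq: "L > 0 \<Longrightarrow> apd_C L (Suc k) = 2 * L * (apd_alpha L (Suc k))\<^sup>2"
  by (simp add: largest_root_root apd_C_nonneg)

text \<open>The quantity \<open>s = sqrt (8 * L * apd_C L k)\<close> grows by at least one per step: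
  the explicit root adds at least \<open>2 * (1 + s)\<close> to \<open>s\<^sup>2\<close>, which is
  more than \<open>(s + 1)\<^sup>2 - s\<^sup>2\<close>.\<close>

lemma apd_C_ge:
  assumes "L > 0"
  shows "apd_C L k \<ge> (real k)\<^sup>2 / (8 * L)"
proof -
  have "sqrt (8 * L * apd_C L k) \<ge> real k"
  proof (induction k)
    case (Suc k)
    define s where "s = sqrt (8 * L * apd_C L k)"
    have s: "s\<^sup>2 = 8 * L * apd_C L k" "s \<ge> 0"
      using assms apd_C_nonneg[OF assms, of k] by (auto simp: s_def)
    have "s \<le> sqrt (1 + 8 * L * apd_C L k)"
      unfolding s_def by simp
    then have "8 * L * apd_alpha L (Suc k) \<ge> 2 * (1 + s)"
      using assms apd_C_nonneg[OF assms, of k] by (simp add: largest_root_eq)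
    then have "8 * L * apd_C L (Suc k) \<ge> s\<^sup>2 + 2 * (1 + s)"
      unfolding s(1) by (simp add: algebra_simps)
    also have "s\<^sup>2 + 2 * (1 + s) \<ge> (s + 1)\<^sup>2"
      by (simp add: power2_eq_square algebra_simps)
    finally have "sqrt (8 * L * apd_C L (Suc k)) \<ge> s + 1"
      by (rule real_le_rsqrt)
    with Suc show ?case
      by (simp add: s_def)
  qed auto
  then have "(real k)\<^sup>2 \<le> 8 * L * apd_C L k"
    using power_mono[of "real k" "sqrt (8 * L * apd_C L k)" 2] assms apd_C_nonneg[OF assms, of k]
    by simp
  then show ?thesis
    using assms by (simp add: pos_divide_le_eq mult.commute)
qed

text \<open>As \<open>apd_C L 0 = 0\<close>, the first step puts all weight on the new point and
  forgets the arbitrary \<open>x0\<close>.\<close>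

lemma apd_tau_0 [simp]: "L > 0 \<Longrightarrow> apd_tau L (Suc 0) = 1"
  using apd_alpha_pos[of L 0] by (simp add: apd_tau_def)

lemma apd_tau_bounds:
  assumes "L > 0"
  shows "0 \<le> apd_tau L (Suc k)" "apd_tau L (Suc k) \<le> 1"
  using apd_alpha_pos[OF assms, of k] apd_C_pos[OF assms, of k] apd_C_nonneg[OF assms, of k] apd_C_Suc[of L k]
  unfolding apd_tau_def by (auto intro!: divide_nonneg_nonneg simp del: apd_C.simps apd_alpha.simps)

text \<open>These are the coefficients that appear when a recursion in \<tau> is multiplied by
  \<open>apd_C L (Suc k)\<close>; they turn convex combinations into running weighted sums.\<close>

lemma apd_C_tau:
  assumes "L > 0"
  shows "apd_C L (Suc k) * apd_tau L (Suc k) = apd_alpha L (Suc k)"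
    and "apd_C L (Suc k) * (1 - apd_tau L (Suc k)) = apd_C L k"
  using apd_C_pos[OF assms, of k] apd_C_Suc[of L k]
  by (auto simp: apd_tau_def right_diff_distrib simp del: apd_C.simps apd_alpha.simps)

section \<open>The iterates as recursions and weighted sums\<close>

definition apd_zeta where
  "apd_zeta L xsol A b x0 y k = fst (snd (apdsgm L xsol A b x0 y k))"

definition apd_eta where
  "apd_eta L xsol A b x0 y k = fst (snd (snd (apdsgm L xsol A b x0 y k)))"

lemmas apd_defs = apd_lambda_def apd_zeta_def apd_eta_def apd_xhat_def

lemma apd_0:
  "apd_lambda L xsol A b x0 y 0 = 0" "apd_zeta L xsol A b x0 y 0 = 0"
  "apd_eta L xsol A b x0 y 0 = 0" "apd_xhat L xsol A b x0 y 0 = x0"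
  by (simp_all add: apd_defs)

lemma apd_Suc:
  fixes L xsol A b x0 y k
  defines "\<tau> \<equiv> apd_tau L (Suc k)"
  shows apd_lambda_Suc: "apd_lambda L xsol A b x0 y (Suc k) =
      \<tau> *\<^sub>R apd_zeta L xsol A b x0 y k + (1 - \<tau>) *\<^sub>R apd_eta L xsol A b x0 y k"
    and apd_zeta_Suc: "apd_zeta L xsol A b x0 y (Suc k) =
      apd_zeta L xsol A b x0 y k - apd_alpha L (Suc k) *\<^sub>R
        stoch_grad xsol A b (apd_lambda L xsol A b x0 y (Suc k)) (y (Suc k))"
    and apd_eta_Suc: "apd_eta L xsol A b x0 y (Suc k) =
      \<tau> *\<^sub>R apd_zeta L xsol A b x0 y (Suc k) + (1 - \<tau>) *\<^sub>R apd_eta L xsol A b x0 y k"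
    and apd_xhat_Suc: "apd_xhat L xsol A b x0 y (Suc k) =
      \<tau> *\<^sub>R xsol (apd_lambda L xsol A b x0 y (Suc k)) (y (Suc k))
        + (1 - \<tau>) *\<^sub>R apd_xhat L xsol A b x0 y k"
  by (simp_all add: apd_defs Let_def case_prod_unfold \<tau>_def)

text \<open>Causality of the method. It lets the state factor through the first \<open>k\<close>
  realizations, as needed to use the independence of the next one.\<close>

lemma apd_cong:
  assumes "\<And>i. i \<in> {1..k} \<Longrightarrow> y i = y' i"
  shows "apdsgm L xsol A b x0 y k = apdsgm L xsol A b x0 y' k"
  using assms by (induction k) auto

text \<open>Multiplied by \<open>apd_C\<close>, the recursion for \<open>apd_xhat\<close>
  telescopes; \<open>x0\<close> enters with weight \<open>apd_C L 0 = 0\<close>.\<close>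

lemma apd_xhat_sum:
  fixes xsol :: "'h::euclidean_space \<Rightarrow> 'x \<Rightarrow> 'e::euclidean_space"
  assumes "L > 0"
  shows "apd_C L n *\<^sub>R apd_xhat L xsol A b x0 y n =
    (\<Sum>k=1..n. apd_alpha L k *\<^sub>R xsol (apd_lambda L xsol A b x0 y k) (y k))"
proof (induction n)
  case (Suc n)
  then show ?case
    using apd_C_tau[OF assms, of n]
    by (simp add: apd_xhat_Suc scaleR_add_right del: apd_C.simps(2) apd_alpha.simps)
qed simp

lemma apd_C_sum: "apd_C L n = (\<Sum>k=1..n. apd_alpha L k)"
  by (induction n) auto

lemma apd_xhat_in_convex:
  assumes "L > 0" "convex Q" "\<And>k. k \<in> {1..Suc n} \<Longrightarrow> xsol (apd_lambda L xsol A b x0 y k) (y k) \<in> Q"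
  shows "apd_xhat L xsol A b x0 y (Suc n) \<in> Q"
  using assms(3)
proof (induction n)
  case 0
  then show ?case
    using assms(1) by (simp add: apd_xhat_Suc)
next
  case (Suc n)
  then show ?case
    unfolding apd_xhat_Suc[of L xsol A b x0 y "Suc n"]
    using assms(1) by (intro convexD[OF assms(2)] apd_tau_bounds Suc) (auto simp: apd_tau_bounds)
qed

section \<open>Convex analysis\<close>

text \<open>Subtracting the affine minorant leaves a differentiable function with a minimum at
  \<open>l\<close>, so its gradient \<open>D - v\<close> vanishes there.\<close>

lemma GDERIV_subgradient_unique:
  fixes \<phi> :: "'h::euclidean_space \<Rightarrow> real"
  assumes "GDERIV \<phi> l :> D" "\<And>m. \<phi> m \<ge> \<phi> l + v \<bullet> (m - l)"
  shows "v = D"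
proof -
  define h where "h m = \<phi> m - \<phi> l - v \<bullet> (m - l)" for m
  have h: "(h has_derivative (\<lambda>x. x \<bullet> (D - v))) (at l)"
    unfolding h_def using assms(1)[unfolded gderiv_def]
    by (auto intro!: derivative_eq_intros simp: inner_diff inner_commute)
  have "h l \<le> h m" for m
    using assms(2)[of m] by (simp add: h_def)
  then have "(\<lambda>x. x \<bullet> (D - v)) = (\<lambda>_. 0)"
    by (intro differential_zero_maxmin[OF _ open_UNIV h]) auto
  then have "(D - v) \<bullet> (D - v) = 0"
    by meson
  then show ?thesis by simp
qed

text \<open>Along the segment from \<open>l\<close> to \<open>m\<close>, \<phi> minus its quadratic
  model has nonpositive derivative, by Cauchy-Schwarz and the Lipschitz bound on
  \<open>g\<close>.\<close>

lemma descent_lemma: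
  fixes \<phi> :: "'h::euclidean_space \<Rightarrow> real"
  assumes g: "\<And>l. GDERIV \<phi> l :> g l" and lip: "lipschitz_on L UNIV g"
  shows "\<phi> m \<le> \<phi> l + g l \<bullet> (m - l) + L / 2 * (norm (m - l))\<^sup>2"
proof -
  define d where "d = m - l"
  define h where "h t = \<phi> (l + t *\<^sub>R d) - t * (g l \<bullet> d) - L / 2 * t\<^sup>2 * (norm d)\<^sup>2" for t
  have "h 1 \<le> h 0"
  proof (rule DERIV_nonpos_imp_nonincreasing[of 0 1 h])
    fix t :: real assume t: "0 \<le> t" "t \<le> 1"
    have "((\<lambda>t. \<phi> (l + t *\<^sub>R d)) has_derivative (\<lambda>s. (s *\<^sub>R d) \<bullet> g (l + t *\<^sub>R d))) (at t)"
      by (rule has_derivative_compose[OF _ g[unfolded gderiv_def]])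
        (auto intro!: derivative_eq_intros)
    then have 1: "((\<lambda>t. \<phi> (l + t *\<^sub>R d)) has_real_derivative (g (l + t *\<^sub>R d) \<bullet> d)) (at t)"
      unfolding has_field_derivative_def
      by (rule has_derivative_eq_rhs) (simp add: fun_eq_iff inner_commute)
    have D: "(h has_real_derivative (g (l + t *\<^sub>R d) \<bullet> d - g l \<bullet> d - L * t * (norm d)\<^sup>2)) (at t)"
      unfolding h_def by (auto intro!: derivative_eq_intros 1)
    have "(g (l + t *\<^sub>R d) - g l) \<bullet> d \<le> norm (g (l + t *\<^sub>R d) - g l) * norm d"
      by (rule norm_cauchy_schwarz)
    also have "norm (g (l + t *\<^sub>R d) - g l) \<le> L * t * norm d"
      using lipschitz_onD[OF lip, of "l + t *\<^sub>R d" l] t by (simp add: dist_norm)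
    finally have "g (l + t *\<^sub>R d) \<bullet> d - g l \<bullet> d - L * t * (norm d)\<^sup>2 \<le> 0"
      by (simp add: inner_diff_left power2_eq_square mult.assoc mult_right_mono)
    with D show "\<exists>y. (h has_real_derivative y) (at t) \<and> y \<le> 0"
      by blast
  qed auto
  then show ?thesis
    by (simp add: h_def d_def)
qed

text \<open>
  The relation \<open>C' = 2 L \<alpha>\<^sup>2\<close> gives \<open>L C' \<tau>\<^sup>2 = 1/2\<close>: one half of the quadratic term
  \<open>\<parallel>\<zeta>' - \<zeta>\<parallel>\<^sup>2 / 2\<close> of the mirror step pays for the smoothness of \<open>\<phi>\<close>, the other half absorbs
  the error \<open>\<delta>\<close> by Young's inequality.
\<close>

lemma accelerated_step:
  fixes \<phi> :: "'h::euclidean_space \<Rightarrow> real" and l' \<zeta> \<eta> g :: 'h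
  assumes "C \<ge> 0" "\<alpha> > 0" "L > 0" and C': "C' = C + \<alpha>" "C' = 2 * L * \<alpha>\<^sup>2"
    and l': "l' = (\<alpha> / C') *\<^sub>R \<zeta> + (1 - \<alpha> / C') *\<^sub>R \<eta>"
    and \<zeta>': "\<zeta>' = \<zeta> - \<alpha> *\<^sub>R g"
    and \<eta>': "\<eta>' = (\<alpha> / C') *\<^sub>R \<zeta>' + (1 - \<alpha> / C') *\<^sub>R \<eta>"
    and convex: "\<phi> \<eta> \<ge> \<phi> l' + D \<bullet> (\<eta> - l')"
    and smooth: "\<phi> \<eta>' \<le> \<phi> l' + D \<bullet> (\<eta>' - l') + L / 2 * (norm (\<eta>' - l'))\<^sup>2"
  defines "\<delta> \<equiv> g - D"
  shows "C' * \<phi> \<eta>' + (norm (\<zeta>' - u))\<^sup>2 / 2 \<le> C * \<phi> \<eta> + (norm (\<zeta> - u))\<^sup>2 / 2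
    + \<alpha> * (\<phi> l' + g \<bullet> (u - l')) + C * (\<delta> \<bullet> (\<eta> - l')) + C' * (norm \<delta>)\<^sup>2 / (2 * L)"
proof -
  have "C' > 0" using assms by simp
  define p where "p = \<eta>' - l'"
  \<comment> \<open>Both points use the same weights and the same \<eta>, so they differ only
    through the move from \<zeta> to \<zeta>'.\<close>
  have p: "p = (\<alpha> / C') *\<^sub>R (\<zeta>' - \<zeta>)"
    by (simp add: p_def \<eta>' l' algebra_simps)
  have Cp: "C' *\<^sub>R p = - (\<alpha>\<^sup>2) *\<^sub>R g"
    using \<open>C' > 0\<close> by (simp add: p \<zeta>' power2_eq_square)
  have "C' * (L * (norm p)\<^sup>2) = (norm (\<alpha> *\<^sub>R g))\<^sup>2 / 2"
  proof -
    have "p = - (\<alpha>\<^sup>2 / C') *\<^sub>R g"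
      using \<open>C' > 0\<close> by (simp add: p \<zeta>' power2_eq_square)
    then have "(norm p)\<^sup>2 = (\<alpha>\<^sup>2 / C')\<^sup>2 * (norm g)\<^sup>2"
      by (simp add: power_mult_distrib power_divide)
    also have "\<alpha>\<^sup>2 / C' = 1 / (2 * L)"
      using \<open>\<alpha> > 0\<close> \<open>L > 0\<close> by (simp add: C'(2))
    finally show ?thesis
      using \<open>L > 0\<close> \<open>\<alpha> > 0\<close>
      by (simp add: C'(2) power_mult_distrib power_divide field_simps power2_eq_square)
  qed
  moreover have "- (\<delta> \<bullet> p) \<le> L / 2 * (norm p)\<^sup>2 + (norm \<delta>)\<^sup>2 / (2 * L)"
  proof -
    have "0 \<le> (norm (L *\<^sub>R p + \<delta>))\<^sup>2 / (2 * L)"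
      using \<open>L > 0\<close> by simp
    also have "\<dots> = L / 2 * (norm p)\<^sup>2 + (norm \<delta>)\<^sup>2 / (2 * L) + \<delta> \<bullet> p"
      using \<open>L > 0\<close> unfolding power2_norm_eq_inner
      by (simp add: inner_add inner_commute field_simps power2_eq_square)
    finally show ?thesis by simp
  qed
  then have "\<phi> \<eta>' \<le> \<phi> l' + g \<bullet> p + L * (norm p)\<^sup>2 + (norm \<delta>)\<^sup>2 / (2 * L)"
    using smooth by (simp add: p_def[symmetric] \<delta>_def inner_diff_left)
  then have "C' * \<phi> \<eta>' \<le> C' * (\<phi> l' + g \<bullet> p + L * (norm p)\<^sup>2 + (norm \<delta>)\<^sup>2 / (2 * L))"
    using \<open>C' > 0\<close> by simp
  moreover have "C' * (g \<bullet> p) = - (norm (\<alpha> *\<^sub>R g))\<^sup>2"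
  proof -
    have "C' * (g \<bullet> p) = g \<bullet> (C' *\<^sub>R p)" by simp
    then show ?thesis
      unfolding Cp by (simp add: power_mult_distrib power2_norm_eq_inner)
  qed
  ultimately have 1: "C' * \<phi> \<eta>' \<le> C' * \<phi> l' - (norm (\<alpha> *\<^sub>R g))\<^sup>2 / 2 + C' * (norm \<delta>)\<^sup>2 / (2 * L)"
    by (simp add: algebra_simps)
  have 2: "(norm (\<zeta>' - u))\<^sup>2 / 2 = (norm (\<zeta> - u))\<^sup>2 / 2 + \<alpha> * (g \<bullet> (u - \<zeta>)) + (norm (\<alpha> *\<^sub>R g))\<^sup>2 / 2"
  proof -
    have sq: "(norm (v - w))\<^sup>2 = (norm v)\<^sup>2 - 2 * (w \<bullet> v) + (norm w)\<^sup>2" for v w :: 'h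
      unfolding power2_norm_eq_inner by (simp add: inner_diff inner_commute)
    have "\<zeta>' - u = (\<zeta> - u) - \<alpha> *\<^sub>R g"
      by (simp add: \<zeta>')
    then have "(norm (\<zeta>' - u))\<^sup>2 = (norm (\<zeta> - u))\<^sup>2 + 2 * (\<alpha> * (g \<bullet> (u - \<zeta>))) + (norm (\<alpha> *\<^sub>R g))\<^sup>2"
      by (simp only: sq) (simp add: inner_diff_right algebra_simps)
    then show ?thesis
      by simp
  qed
  \<comment> \<open>Coupling of the two sequences: since \<open>l'\<close> is the weighted mean of
    \<zeta> and \<eta>, the linear term at \<zeta> from the mirror step can be moved to
    \<open>l'\<close> at the price of a term at \<eta>, which convexity then controls.\<close>
  have "\<alpha> *\<^sub>R (l' - \<zeta>) = C *\<^sub>R (\<eta> - l')"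
  proof -
    have "C' *\<^sub>R l' = \<alpha> *\<^sub>R \<zeta> + C *\<^sub>R \<eta>"
      using \<open>C' > 0\<close> by (simp add: l' scaleR_add_right right_diff_distrib) (simp add: C'(1))
    then show ?thesis
      by (simp add: C'(1) algebra_simps)
  qed
  then have "\<alpha> * (g \<bullet> (l' - \<zeta>)) = C * (g \<bullet> (\<eta> - l'))"
    by (metis inner_scaleR_right)
  then have 3: "\<alpha> * (g \<bullet> (u - \<zeta>)) = \<alpha> * (g \<bullet> (u - l')) + C * (g \<bullet> (\<eta> - l'))"
    by (simp add: algebra_simps inner_diff_right)
  have "C * (\<phi> l' + D \<bullet> (\<eta> - l')) \<le> C * \<phi> \<eta>"
    using convex \<open>C \<ge> 0\<close> by (rule mult_left_mono)
  then have 4: "C * \<phi> l' + C * (g \<bullet> (\<eta> - l')) \<le> C * \<phi> \<eta> + C * (\<delta> \<bullet> (\<eta> - l'))"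
    by (simp add: \<delta>_def algebra_simps inner_diff_left)
  show ?thesis
    using 1 2 3 4 C'(1) by (simp add: algebra_simps)
qed

text \<open>One half of Fenchel-Moreau duality in approximate form: the slope \<open>s\<close> of a
  hyperplane separating \<open>(x, t)\<close> from the closed epigraph has conjugate value at most
  \<open>s \<bullet> x - t\<close>, with \<open>t\<close> as close to \<open>f x\<close> as
  desired.\<close>

lemma convex_conjugate_minorant:
  fixes f :: "'e::euclidean_space \<Rightarrow> real"
  assumes "convex_on Q f" "closed (epigraph Q f)" "x \<in> Q" "t < f x"
  obtains s where "\<And>y. y \<in> Q \<Longrightarrow> s \<bullet> y - f y \<le> s \<bullet> x - t"
proof -
  have "(x, t) \<notin> epigraph Q f"
    using assms by (simp add: mem_epigraph)
  then obtain a \<beta> where a: "a \<bullet> (x, t) < \<beta>" "\<And>z. z \<in> epigraph Q f \<Longrightarrow> a \<bullet> z > \<beta>"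
    using separating_hyperplane_closed_point[OF convex_epigraphI[OF assms(1)] assms(2)] by metis
  obtain v r where vr: "a = (v, r)" by force
  have sep: "v \<bullet> x + r * t < v \<bullet> y + r * f y" if "y \<in> Q" for y
    using a(1) a(2)[of "(y, f y)"] that by (simp add: vr mem_epigraph)
  \<comment> \<open>Comparing with \<open>(x, f x)\<close>, which lies above \<open>(x, t)\<close>
    in the epigraph, rules out a vertical hyperplane.\<close>
  from sep[OF assms(3)] have "0 < r * (f x - t)"
    by (simp add: algebra_simps)
  then have "r > 0"
    using assms(4) by (simp add: zero_less_mult_iff)
  show ?thesis
  proof (rule that[of "- (1 / r) *\<^sub>R v"])
    fix y assume "y \<in> Q"
    then have "(v \<bullet> x + r * t) / r \<le> (v \<bullet> y + r * f y) / r"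
      using sep[of y] \<open>r > 0\<close> by (intro divide_right_mono) auto
    then show "(- (1 / r) *\<^sub>R v) \<bullet> y - f y \<le> (- (1 / r) *\<^sub>R v) \<bullet> x - t"
      using \<open>r > 0\<close> by (simp add: add_divide_distrib)
  qed
qed

text \<open>An infinite positive part would make the difference \<infinity>, and an infinite
  negative part alone would make it -\<infinity>. Hence a finite value forces both parts to be
  finite, which is integrability.\<close>

lemma ereal_expectation_finite:
  assumes [measurable]: "g \<in> borel_measurable M" and fin: "ereal_expectation M g = ereal c"
  shows "AE w in M. \<bar>g w\<bar> \<noteq> \<infinity>" "has_bochner_integral M (\<lambda>w. real_of_ereal (g w)) c"
proof -
  define p where "p = (\<integral>\<^sup>+ w. e2ennreal (g w) \<partial>M)"
  define n where "n = (\<integral>\<^sup>+ w. e2ennreal (- g w) \<partial>M)"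
  have c: "enn2ereal p - enn2ereal n = ereal c"
    using fin by (simp add: ereal_expectation_def p_def n_def)
  then have "p \<noteq> \<infinity>" "n \<noteq> \<infinity>"
    by (cases p; cases n; simp)+
  then have "AE w in M. e2ennreal (g w) \<noteq> \<infinity>" "AE w in M. e2ennreal (- g w) \<noteq> \<infinity>"
    unfolding p_def n_def by (intro nn_integral_PInf_AE; measurable; simp)+
  then show AE: "AE w in M. \<bar>g w\<bar> \<noteq> \<infinity>"
  proof eventually_elim
    case (elim w)
    then show ?case by (cases "g w") (auto simp: e2ennreal_infty)
  qed
  have "p = (\<integral>\<^sup>+ w. ennreal (real_of_ereal (g w)) \<partial>M)"
    unfolding p_def using AE by (intro nn_integral_cong_AE) (auto elim!: eventually_mono simp: ennreal.abs_eq)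
  moreover have "n = (\<integral>\<^sup>+ w. ennreal (- real_of_ereal (g w)) \<partial>M)"
    unfolding n_def using AE by (intro nn_integral_cong_AE) (auto elim!: eventually_mono simp: ennreal.abs_eq)
  ultimately have "integrable M (\<lambda>w. real_of_ereal (g w))"
    "(\<integral>w. real_of_ereal (g w) \<partial>M) = enn2real p - enn2real n"
    using \<open>p \<noteq> \<infinity>\<close> \<open>n \<noteq> \<infinity>\<close>
    by (simp_all add: real_integrable_def real_lebesgue_integral_def)
  moreover have "enn2real p - enn2real n = c"
    using c by (cases p; cases n; simp add: enn2ereal_ennreal)
  ultimately show "has_bochner_integral M (\<lambda>w. real_of_ereal (g w)) c"
    by (simp add: has_bochner_integral_iff)
qed

section \<open>Conjugates, sample subgradients and weak duality\<close>

lemma arg_max_fenchel_conjugate: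
  assumes "is_arg_max (\<lambda>x. ereal (s \<bullet> x) - g x) (\<lambda>x. x \<in> Q) x"
  shows "fenchel_conjugate Q g s = ereal (s \<bullet> x) - g x"
  unfolding fenchel_conjugate_def using assms
  by (intro antisym SUP_least SUP_upper) (auto simp: is_arg_max_def not_less)

text \<open>The Fenchel-Young inequality is an equality at \<open>s0\<close>, where \<open>x\<close>
  attains the maximum, and holds at \<open>s\<close> because \<open>sample_primal\<close> is a
  supremum over all slopes. Subtracting the two gives the claim.\<close>

lemma sample_primal_arg_max_subgradient:
  assumes fin: "\<bar>Fstar s0 y\<bar> \<noteq> \<infinity>" "\<bar>Fstar s y\<bar> \<noteq> \<infinity>"
    and conj: "Fstar s0 y = fenchel_conjugate Q (\<lambda>x. sample_primal Fstar x y) s0"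
    and max: "is_arg_max (\<lambda>x. ereal (s0 \<bullet> x) - sample_primal Fstar x y) (\<lambda>x. x \<in> Q) x"
  shows "real_of_ereal (Fstar s y) \<ge> real_of_ereal (Fstar s0 y) + (s - s0) \<bullet> x"
proof -
  have "Fstar s0 y = ereal (s0 \<bullet> x) - sample_primal Fstar x y"
    using conj arg_max_fenchel_conjugate[OF max] by simp
  moreover have "ereal (s \<bullet> x) - Fstar s y \<le> sample_primal Fstar x y"
    unfolding sample_primal_def fenchel_conjugate_def by (auto intro!: SUP_upper2[of s] simp: inner_commute)
  ultimately show ?thesis
    using fin by (cases "Fstar s0 y"; cases "Fstar s y"; cases "sample_primal Fstar x y")
      (auto simp: inner_diff_left)
qed

lemma dual_objective_attained:
  assumes max: "is_arg_max (\<lambda>x. - f x - adjoint A l \<bullet> x) (\<lambda>x. x \<in> Q) x" and "linear A"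
  shows "dual_objective Q f A b l = l \<bullet> (b - A x) - f x"
proof -
  have "is_arg_max (\<lambda>x. ereal (- adjoint A l \<bullet> x) - ereal (f x)) (\<lambda>x. x \<in> Q) x"
    using max by (simp add: is_arg_max_def algebra_simps)
  then show ?thesis
    using arg_max_fenchel_conjugate[of "- adjoint A l" "\<lambda>x. ereal (f x)" Q x]
    by (simp add: dual_objective_def inner_diff_right adjoint_clauses[OF \<open>linear A\<close>])
qed

text \<open>Weak duality before feasibility is imposed. The maximizer \<open>x0\<close> makes the
  conjugate finite, so \<open>real_of_ereal\<close> does not return its default value.\<close>

lemma dual_objective_ge:
  assumes max: "is_arg_max (\<lambda>x. - f x - adjoint A l \<bullet> x) (\<lambda>x. x \<in> Q) x0" and "linear A" "x \<in> Q"
  shows "dual_objective Q f A b l \<ge> l \<bullet> (b - A x) - f x"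
  using max \<open>x \<in> Q\<close> unfolding dual_objective_attained[OF max \<open>linear A\<close>]
  by (auto simp: is_arg_max_def not_less inner_diff_right adjoint_clauses[OF \<open>linear A\<close>])

section \<open>Expectation, independence and square integrability\<close>

text \<open>A mean outside \<open>Q\<close> would be strictly separated from \<open>Q\<close> by a
  hyperplane, and integrating the separating inequality contradicts this.\<close>

lemma (in prob_space) expectation_in_closed_convex:
  fixes Z :: "'a \<Rightarrow> 'e::euclidean_space"
  assumes Q: "closed Q" "convex Q" and Z: "integrable M Z" "\<And>w. w \<in> space M \<Longrightarrow> Z w \<in> Q"
  shows "expectation Z \<in> Q"
proof (rule ccontr)
  assume "expectation Z \<notin> Q"
  then obtain a \<beta> where a: "a \<bullet> expectation Z < \<beta>" "\<And>x. x \<in> Q \<Longrightarrow> a \<bullet> x > \<beta>"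
    using separating_hyperplane_closed_point[OF Q(2,1)] by metis
  have "\<beta> = expectation (\<lambda>_. \<beta>)"
    by (simp add: prob_space)
  also have "\<dots> \<le> expectation (\<lambda>w. a \<bullet> Z w)"
    using Z a(2) by (intro integral_mono) (auto intro: less_imp_le)
  also have "\<dots> = a \<bullet> expectation Z"
    using Z(1) by simp
  finally show False using a(1) by simp
qed

text \<open>The library's \<open>indep_var\<close> requires both random variables to have values in the same type.\<close>

definition (in prob_space) indep_pair ::
    "'b measure \<Rightarrow> ('a \<Rightarrow> 'b) \<Rightarrow> 'c measure \<Rightarrow> ('a \<Rightarrow> 'c) \<Rightarrow> bool" where
  "indep_pair S U T Y \<longleftrightarrow> U \<in> M \<rightarrow>\<^sub>M S \<and> Y \<in> M \<rightarrow>\<^sub>M T \<and>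
    distr M S U \<Otimes>\<^sub>M distr M T Y = distr M (S \<Otimes>\<^sub>M T) (\<lambda>w. (U w, Y w))"

lemma (in prob_space) indep_pair_iff_indep_var: "indep_pair S U T Y \<longleftrightarrow> indep_var S U T Y"
  by (simp add: indep_pair_def indep_var_distribution_eq)

lemma (in prob_space) indep_pair_compose:
  assumes indep: "indep_pair S U T Y" and [measurable]: "f \<in> S \<rightarrow>\<^sub>M S'" "g \<in> T \<rightarrow>\<^sub>M T'"
  shows "indep_pair S' (f \<circ> U) T' (g \<circ> Y)"
proof -
  have [measurable]: "U \<in> M \<rightarrow>\<^sub>M S" "Y \<in> M \<rightarrow>\<^sub>M T"
    using indep by (auto simp: indep_pair_def)
  interpret G: prob_space "distr M T' (g \<circ> Y)"
    by (rule prob_space_distr) measurable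
  have "distr M S' (f \<circ> U) \<Otimes>\<^sub>M distr M T' (g \<circ> Y)
      = distr (distr M S U) S' f \<Otimes>\<^sub>M distr (distr M T Y) T' g"
    by (simp add: distr_distr)
  also have "\<dots> = distr (distr M S U \<Otimes>\<^sub>M distr M T Y) (S' \<Otimes>\<^sub>M T') (\<lambda>(x, y). (f x, g y))"
    by (rule pair_measure_distr) (simp_all add: distr_distr G.sigma_finite_measure_axioms)
  also have "\<dots> = distr (distr M (S \<Otimes>\<^sub>M T) (\<lambda>w. (U w, Y w))) (S' \<Otimes>\<^sub>M T') (\<lambda>(x, y). (f x, g y))"
    using indep by (simp add: indep_pair_def)
  also have "\<dots> = distr M (S' \<Otimes>\<^sub>M T') (\<lambda>w. ((f \<circ> U) w, (g \<circ> Y) w))"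
    by (subst distr_distr) (simp_all add: comp_def)
  finally show ?thesis
    by (simp add: indep_pair_def)
qed

text \<open>Tonelli on the product law: \<open>U\<close> is frozen at its realized value and only
  \<open>Y\<close> is averaged.\<close>

lemma (in prob_space) indep_pair_nn_integral:
  assumes indep: "indep_pair S U T Y" and [measurable]: "g \<in> borel_measurable (S \<Otimes>\<^sub>M T)"
  shows "(\<integral>\<^sup>+ w. g (U w, Y w) \<partial>M) = (\<integral>\<^sup>+ w. \<integral>\<^sup>+ y. g (U w, y) \<partial>distr M T Y \<partial>M)"
proof -
  have [measurable]: "U \<in> M \<rightarrow>\<^sub>M S" "Y \<in> M \<rightarrow>\<^sub>M T"
    using indep by (auto simp: indep_pair_def)
  interpret D: prob_space "distr M T Y"
    by (rule prob_space_distr) measurable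
  have "(\<integral>\<^sup>+ w. g (U w, Y w) \<partial>M) = (\<integral>\<^sup>+ z. g z \<partial>distr M (S \<Otimes>\<^sub>M T) (\<lambda>w. (U w, Y w)))"
    by (simp add: nn_integral_distr)
  also have "\<dots> = (\<integral>\<^sup>+ z. g z \<partial>(distr M S U \<Otimes>\<^sub>M distr M T Y))"
    using indep by (simp add: indep_pair_def)
  also have "\<dots> = (\<integral>\<^sup>+ u. \<integral>\<^sup>+ y. g (u, y) \<partial>distr M T Y \<partial>distr M S U)"
    by (rule D.nn_integral_fst[symmetric]) simp
  also have "\<dots> = (\<integral>\<^sup>+ w. \<integral>\<^sup>+ y. g (U w, y) \<partial>distr M T Y \<partial>M)"
    by (rule nn_integral_distr) measurable
  finally show ?thesis .
qed

text \<open>Freezing by Fubini. The function \<open>G\<close> takes the place of a conditional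
  expectation given \<open>U\<close>.\<close>

lemma (in prob_space) indep_pair_integral:
  fixes g :: "_ \<Rightarrow> _::{banach, second_countable_topology}"
  assumes indep: "indep_pair S U T Y" and [measurable]: "g \<in> borel_measurable (S \<Otimes>\<^sub>M T)"
    and int: "integrable M (\<lambda>w. g (U w, Y w))"
    and G: "\<And>u. u \<in> space S \<Longrightarrow> expectation (\<lambda>w. g (u, Y w)) = G u"
  shows "expectation (\<lambda>w. g (U w, Y w)) = expectation (\<lambda>w. G (U w))"
proof -
  have [measurable]: "U \<in> M \<rightarrow>\<^sub>M S" "Y \<in> M \<rightarrow>\<^sub>M T"
    using indep by (auto simp: indep_pair_def)
  interpret DS: prob_space "distr M S U"
    by (rule prob_space_distr) measurable
  interpret DT: prob_space "distr M T Y"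
    by (rule prob_space_distr) measurable
  interpret pair_sigma_finite "distr M S U" "distr M T Y" ..
  have eq: "distr M S U \<Otimes>\<^sub>M distr M T Y = distr M (S \<Otimes>\<^sub>M T) (\<lambda>w. (U w, Y w))"
    using indep by (simp add: indep_pair_def)
  have "expectation (\<lambda>w. g (U w, Y w)) = integral\<^sup>L (distr M S U \<Otimes>\<^sub>M distr M T Y) g"
    unfolding eq by (simp add: integral_distr)
  also have "\<dots> = (\<integral>u. (\<integral>y. g (u, y) \<partial>distr M T Y) \<partial>distr M S U)"
    using int by (intro integral_fst'[symmetric]) (simp add: eq integrable_distr_eq)
  also have "\<dots> = expectation (\<lambda>w. \<integral>y. g (U w, y) \<partial>distr M T Y)"
    by (rule integral_distr) measurable
  also have "\<dots> = expectation (\<lambda>w. G (U w))"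
  proof (rule Bochner_Integration.integral_cong)
    fix w assume w: "w \<in> space M"
    then have u: "U w \<in> space S"
      by (meson \<open>U \<in> M \<rightarrow>\<^sub>M S\<close> measurable_space)
    then have "(\<integral>y. g (U w, y) \<partial>distr M T Y) = expectation (\<lambda>w'. g (U w, Y w'))"
      by (intro integral_distr) measurable
    then show "(\<integral>y. g (U w, y) \<partial>distr M T Y) = G (U w)"
      using G[OF u] by simp
  qed simp
  finally show ?thesis .
qed

text \<open>A class closed under linear combinations in which inner products of two members are
  integrable; this suits iterates that are random and unbounded.\<close>

definition square_integrable :: "'a measure \<Rightarrow> ('a \<Rightarrow> 'b::euclidean_space) \<Rightarrow> bool" where
  "square_integrable M h \<longleftrightarrow> h \<in> borel_measurable M \<and> integrable M (\<lambda>w. (norm (h w))\<^sup>2)"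

lemma square_integrable_measurable: "square_integrable M h \<Longrightarrow> h \<in> borel_measurable M"
  by (simp add: square_integrable_def)

lemma square_integrable_scaleR:
  "square_integrable M h \<Longrightarrow> square_integrable M (\<lambda>w. c *\<^sub>R h w)"
  by (auto simp: square_integrable_def power_mult_distrib)

lemma square_integrable_bound:
  assumes "square_integrable M h" "g \<in> borel_measurable M" "\<And>w. norm (g w) \<le> norm (h w)"
  shows "square_integrable M g"
  unfolding square_integrable_def
proof
  show "integrable M (\<lambda>w. (norm (g w))\<^sup>2)"
    using assms by (intro Bochner_Integration.integrable_bound[of M "\<lambda>w. (norm (h w))\<^sup>2" "\<lambda>w. (norm (g w))\<^sup>2"])
      (auto simp: square_integrable_def intro!: power_mono)
qed (rule assms)

lemma square_integrable_add:
  assumes "square_integrable M h" "square_integrable M g"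
  shows "square_integrable M (\<lambda>w. h w + g w)"
proof -
  have [measurable]: "h \<in> borel_measurable M" "g \<in> borel_measurable M"
    using assms by (auto simp: square_integrable_def)
  have le: "(norm (a + c))\<^sup>2 \<le> 2 * (norm a)\<^sup>2 + 2 * (norm c)\<^sup>2" for a c :: 'b
    using zero_le_power2[of "norm (a - c)"] unfolding power2_norm_eq_inner
    by (simp add: inner_add inner_diff inner_commute)
  have "integrable M (\<lambda>w. (norm (h w + g w))\<^sup>2)"
    using assms by (intro Bochner_Integration.integrable_bound
        [of M "\<lambda>w. 2 * (norm (h w))\<^sup>2 + 2 * (norm (g w))\<^sup>2" "\<lambda>w. (norm (h w + g w))\<^sup>2"])
      (auto simp: square_integrable_def intro!: order.trans[OF le])
  then show ?thesis
    by (simp add: square_integrable_def)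
qed

lemma square_integrable_diff:
  "square_integrable M h \<Longrightarrow> square_integrable M g \<Longrightarrow> square_integrable M (\<lambda>w. h w - g w)"
  using square_integrable_add[of M h "\<lambda>w. -1 *\<^sub>R g w"] square_integrable_scaleR[of M g "-1"] by simp

lemma square_integrable_inner:
  assumes "square_integrable M h" "square_integrable M g"
  shows "integrable M (\<lambda>w. h w \<bullet> g w)"
proof -
  have [measurable]: "h \<in> borel_measurable M" "g \<in> borel_measurable M"
    using assms by (auto simp: square_integrable_def)
  have le: "\<bar>a \<bullet> c\<bar> \<le> (norm a)\<^sup>2 + (norm c)\<^sup>2" for a c :: 'b
  proof -
    have "\<bar>a \<bullet> c\<bar> \<le> norm a * norm c"
      by (rule Cauchy_Schwarz_ineq2)
    also have "\<dots> \<le> (norm a)\<^sup>2 + (norm c)\<^sup>2"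
      using sum_squares_bound[of "norm a" "norm c"] mult_nonneg_nonneg[OF norm_ge_zero norm_ge_zero, of a c]
      by linarith
    finally show ?thesis .
  qed
  show ?thesis
    using assms by (intro Bochner_Integration.integrable_bound
        [of M "\<lambda>w. (norm (h w))\<^sup>2 + (norm (g w))\<^sup>2" "\<lambda>w. h w \<bullet> g w"])
      (auto simp: square_integrable_def intro!: order.trans[OF le])
qed

lemma (in prob_space) square_integrable_const: "square_integrable M (\<lambda>_. c)"
  by (simp add: square_integrable_def)

lemma (in prob_space) square_integrable_integrable:
  assumes "square_integrable M h"
  shows "integrable M h"
proof -
  have "integrable M (\<lambda>w. h w \<bullet> i)" for i
    using square_integrable_inner[OF assms square_integrable_const] .
  then have "integrable M (\<lambda>w. \<Sum>i\<in>Basis. (h w \<bullet> i) *\<^sub>R i)"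
    by (intro Bochner_Integration.integrable_sum integrable_scaleR_left) auto
  then show ?thesis
    by (simp add: euclidean_representation)
qed

section \<open>The stochastic method in expectation\<close>

lemma linear_borel_measurable:
  fixes A :: "'e::euclidean_space \<Rightarrow> 'h::euclidean_space"
  shows "linear A \<Longrightarrow> A \<in> borel_measurable borel"
  by (intro borel_measurable_continuous_onI linear_continuous_on linear_linear[THEN iffD1]) 
    (simp add: linear_conv_bounded_linear)

lemma stoch_grad_measurable:
  assumes "linear A" "(\<lambda>(l, y). xsol l y) \<in> borel_measurable (borel \<Otimes>\<^sub>M X)"
  shows "(\<lambda>(l, y). stoch_grad xsol A b l y) \<in> borel_measurable (borel \<Otimes>\<^sub>M X)"
proof -
  note [measurable] = assms(2) linear_borel_measurable[OF assms(1)]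
  have "(\<lambda>z. b - A ((\<lambda>(l, y). xsol l y) z)) \<in> borel_measurable (borel \<Otimes>\<^sub>M X)"
    by measurable
  then show ?thesis
    by (simp add: stoch_grad_def case_prod_unfold)
qed

text \<open>The general \<open>Y\<close> allows coordinate projections of a product space, which
  makes the iterates measurable functions of the sequence of realizations itself.\<close>

lemma apd_zeta_eta_measurable:
  fixes xsol :: "'h::euclidean_space \<Rightarrow> 'x \<Rightarrow> 'e::euclidean_space"
  assumes A: "linear A" and xsol: "(\<lambda>(l, y). xsol l y) \<in> borel_measurable (borel \<Otimes>\<^sub>M X)"
    and Y: "\<And>i. i \<in> {1..k} \<Longrightarrow> Y i \<in> M \<rightarrow>\<^sub>M X"
  shows "(\<lambda>w. apd_zeta L xsol A b x0 (\<lambda>i. Y i w) k) \<in> borel_measurable M"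
    and "(\<lambda>w. apd_eta L xsol A b x0 (\<lambda>i. Y i w) k) \<in> borel_measurable M"
proof -
  have "(\<lambda>w. apd_zeta L xsol A b x0 (\<lambda>i. Y i w) k) \<in> borel_measurable M \<and>
    (\<lambda>w. apd_eta L xsol A b x0 (\<lambda>i. Y i w) k) \<in> borel_measurable M"
    using Y
  proof (induction k)
    case 0
    then show ?case by (simp add: apd_0)
  next
    case (Suc k)
    then have [measurable]: "(\<lambda>w. apd_zeta L xsol A b x0 (\<lambda>i. Y i w) k) \<in> borel_measurable M"
      "(\<lambda>w. apd_eta L xsol A b x0 (\<lambda>i. Y i w) k) \<in> borel_measurable M" "Y (Suc k) \<in> M \<rightarrow>\<^sub>M X"
      by auto
    have [measurable]: "(\<lambda>w. apd_lambda L xsol A b x0 (\<lambda>i. Y i w) (Suc k)) \<in> borel_measurable M"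
      unfolding apd_lambda_Suc by measurable
    have [measurable]: "(\<lambda>w. stoch_grad xsol A b (apd_lambda L xsol A b x0 (\<lambda>i. Y i w) (Suc k)) (Y (Suc k) w))
        \<in> borel_measurable M"
      using measurable_compose[OF measurable_Pair stoch_grad_measurable[OF A xsol],
          of "\<lambda>w. apd_lambda L xsol A b x0 (\<lambda>i. Y i w) (Suc k)" M "Y (Suc k)"] by simp
    have [measurable]: "(\<lambda>w. apd_zeta L xsol A b x0 (\<lambda>i. Y i w) (Suc k)) \<in> borel_measurable M"
      unfolding apd_zeta_Suc by measurable
    have "(\<lambda>w. apd_eta L xsol A b x0 (\<lambda>i. Y i w) (Suc k)) \<in> borel_measurable M"
      unfolding apd_eta_Suc by measurable
    then show ?case
      by simp
  qed
  then show "(\<lambda>w. apd_zeta L xsol A b x0 (\<lambda>i. Y i w) k) \<in> borel_measurable M"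
    "(\<lambda>w. apd_eta L xsol A b x0 (\<lambda>i. Y i w) k) \<in> borel_measurable M"
    by auto
qed

text \<open>The dual half of the argument: an unbiased convex stochastic oracle without
  \<open>f\<close>, \<open>Q\<close> or \<open>Fstar\<close>. The sample conjugates enter through
  \<open>\<Phi>_subgradient\<close>, and \<open>variance\<close> expresses a conditional bound by
  integrating over the law of \<open>xi k\<close> with the query point frozen.\<close>

locale stochastic_dual_method = prob_space P
  for P :: "'w measure" +
  fixes X :: "'x measure"
    and xi :: "nat \<Rightarrow> 'w \<Rightarrow> 'x"
    and A :: "'e::euclidean_space \<Rightarrow> 'h::euclidean_space"
    and b :: 'h
    and xsol :: "'h \<Rightarrow> 'x \<Rightarrow> 'e"
    and \<phi> :: "'h \<Rightarrow> real"
    and gradphi :: "'h \<Rightarrow> 'h"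
    and \<Phi> :: "'h \<Rightarrow> 'x \<Rightarrow> real"
    and x0 :: 'e
    and L \<epsilon> :: real
    and N :: nat
  assumes linear_A: "linear A"
    and fresh: "indep_vars (\<lambda>_. X) xi {1..N}"
    and xsol_measurable: "(\<lambda>(l, y). xsol l y) \<in> borel_measurable (borel \<Otimes>\<^sub>M X)"
    and \<Phi>_measurable: "(\<lambda>(l, y). \<Phi> l y) \<in> borel_measurable (borel \<Otimes>\<^sub>M X)"
    and \<Phi>_subgradient:
      "\<And>l m y. y \<in> space X \<Longrightarrow> \<Phi> m y \<ge> \<Phi> l y + stoch_grad xsol A b l y \<bullet> (m - l)"
    and \<Phi>_unbiased: "\<And>k l. k \<in> {1..N} \<Longrightarrow> has_bochner_integral P (\<lambda>w. \<Phi> l (xi k w)) (\<phi> l)"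
    and grad_unbiased:
      "\<And>k l. k \<in> {1..N} \<Longrightarrow> has_bochner_integral P (\<lambda>w. stoch_grad xsol A b l (xi k w)) (gradphi l)"
    and \<phi>_grad: "\<And>l. GDERIV \<phi> l :> gradphi l"
    and \<phi>_smooth: "lipschitz_on L UNIV gradphi"
    and L_pos: "L > 0" and \<epsilon>_pos: "\<epsilon> > 0" and N_pos: "N \<ge> 1"
    and variance:
      "\<And>k. k \<in> {1..N} \<Longrightarrow>
         AE w in P. (\<integral>\<^sup>+ y. ennreal ((norm (stoch_grad xsol A b (apd_lambda L xsol A b x0 (\<lambda>j. xi j w) k) y
                           - gradphi (apd_lambda L xsol A b x0 (\<lambda>j. xi j w) k)))\<^sup>2)
                       \<partial>(distr P X (xi k)))
                    \<le> ennreal (\<epsilon> * L * apd_alpha L k / apd_C L k)"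
begin

abbreviation "gradPhi \<equiv> stoch_grad xsol A b"

section \<open>The iterates as random variables and their independence of fresh samples\<close>

definition "lam k w = apd_lambda L xsol A b x0 (\<lambda>j. xi j w) k"
definition "zeta k w = apd_zeta L xsol A b x0 (\<lambda>j. xi j w) k"
definition "eta k w = apd_eta L xsol A b x0 (\<lambda>j. xi j w) k"
definition "grad k w = gradPhi (lam k w) (xi k w)"
definition "err k w = grad k w - gradphi (lam k w)"

lemma iterates_0: "zeta 0 w = 0" "eta 0 w = 0"
  by (simp_all add: zeta_def eta_def apd_0)

lemma lam_Suc: "lam (Suc k) w = apd_tau L (Suc k) *\<^sub>R zeta k w + (1 - apd_tau L (Suc k)) *\<^sub>R eta k w"
  and zeta_Suc: "zeta (Suc k) w = zeta k w - apd_alpha L (Suc k) *\<^sub>R grad (Suc k) w"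
  and eta_Suc: "eta (Suc k) w = apd_tau L (Suc k) *\<^sub>R zeta (Suc k) w + (1 - apd_tau L (Suc k)) *\<^sub>R eta k w"
  by (simp_all only: lam_def zeta_def eta_def grad_def apd_lambda_Suc apd_zeta_Suc apd_eta_Suc)

lemma xi_measurable: "k \<in> {1..N} \<Longrightarrow> xi k \<in> P \<rightarrow>\<^sub>M X"
  using fresh by (auto simp: indep_vars_def)

lemma grad_pair_measurable: "(\<lambda>(l, y). gradPhi l y) \<in> borel_measurable (borel \<Otimes>\<^sub>M X)"
  by (rule stoch_grad_measurable[OF linear_A xsol_measurable])

lemma gradphi_measurable [measurable]: "gradphi \<in> borel_measurable borel"
  by (intro borel_measurable_continuous_onI lipschitz_on_continuous_on[OF \<phi>_smooth])

lemma \<phi>_measurable [measurable]: "\<phi> \<in> borel_measurable borel"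
proof (intro borel_measurable_continuous_onI)
  show "continuous_on UNIV \<phi>"
    using \<phi>_grad unfolding gderiv_def
    by (meson continuous_at_imp_continuous_on has_derivative_continuous)
qed

text \<open>Disjoint blocks of an independent family are independent, and the state after
  \<open>k\<close> steps is a measurable function of the first block.\<close>

lemma indep_history:
  assumes "Suc k \<le> N"
  shows "indep_pair (borel \<Otimes>\<^sub>M borel) (\<lambda>w. (zeta k w, eta k w)) X (xi (Suc k))"
proof -
  let ?state = "\<lambda>v. (apd_zeta L xsol A b x0 v k, apd_eta L xsol A b x0 v k)"
  have "indep_pair (PiM {1..k} (\<lambda>_. X)) (\<lambda>w. \<lambda>i\<in>{1..k}. xi i w)
      (PiM {Suc k} (\<lambda>_. X)) (\<lambda>w. \<lambda>i\<in>{Suc k}. xi i w)"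
    using assms unfolding indep_pair_iff_indep_var by (intro indep_var_restrict[OF fresh]) auto
  moreover have "?state \<in> PiM {1..k} (\<lambda>_. X) \<rightarrow>\<^sub>M borel \<Otimes>\<^sub>M borel"
    by (intro measurable_Pair apd_zeta_eta_measurable[OF linear_A xsol_measurable, where Y="\<lambda>i v. v i"])
      simp_all
  moreover have "(\<lambda>v. v (Suc k)) \<in> PiM {Suc k} (\<lambda>_. X) \<rightarrow>\<^sub>M X"
    by simp
  ultimately have "indep_pair (borel \<Otimes>\<^sub>M borel) (?state \<circ> (\<lambda>w. \<lambda>i\<in>{1..k}. xi i w))
      X ((\<lambda>v. v (Suc k)) \<circ> (\<lambda>w. \<lambda>i\<in>{Suc k}. xi i w))"
    by (rule indep_pair_compose)
  moreover have "?state \<circ> (\<lambda>w. \<lambda>i\<in>{1..k}. xi i w) = (\<lambda>w. (zeta k w, eta k w))"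
  proof
    fix w
    have "apdsgm L xsol A b x0 (\<lambda>i\<in>{1..k}. xi i w) k = apdsgm L xsol A b x0 (\<lambda>i. xi i w) k"
      by (rule apd_cong) simp
    then show "(?state \<circ> (\<lambda>w. \<lambda>i\<in>{1..k}. xi i w)) w = (zeta k w, eta k w)"
      by (simp add: zeta_def eta_def apd_zeta_def apd_eta_def)
  qed
  moreover have "(\<lambda>v. v (Suc k)) \<circ> (\<lambda>w. \<lambda>i\<in>{Suc k}. xi i w) = xi (Suc k)"
    by auto
  ultimately show ?thesis
    by simp
qed

text \<open>The query point is computed from the previous state, before \<open>xi k\<close> is
  drawn.\<close>

lemma indep_lam:
  assumes k: "k \<in> {1..N}"
  shows "indep_pair borel (lam k) X (xi k)"
proof -
  obtain j where j: "k = Suc j" "Suc j \<le> N"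
    using k by (cases k) auto
  have "indep_pair borel ((\<lambda>(z, e). apd_tau L k *\<^sub>R z + (1 - apd_tau L k) *\<^sub>R e) \<circ> (\<lambda>w. (zeta j w, eta j w)))
      X ((\<lambda>x. x) \<circ> xi k)"
    using indep_history[OF j(2)] unfolding j(1) by (rule indep_pair_compose) simp_all
  moreover have "(\<lambda>(z, e). apd_tau L k *\<^sub>R z + (1 - apd_tau L k) *\<^sub>R e) \<circ> (\<lambda>w. (zeta j w, eta j w)) = lam k"
    by (simp add: fun_eq_iff j(1) lam_Suc)
  ultimately show ?thesis
    by (simp add: comp_def)
qed

lemma lam_measurable: "k \<in> {1..N} \<Longrightarrow> lam k \<in> borel_measurable P"
  using indep_lam by (simp add: indep_pair_def)

lemma grad_measurable:
  assumes "k \<in> {1..N}"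
  shows "grad k \<in> borel_measurable P"
  using measurable_compose[OF measurable_Pair[OF lam_measurable[OF assms] xi_measurable[OF assms]]
      grad_pair_measurable] by (simp add: grad_def[abs_def])

lemma \<Phi>_lam_measurable:
  assumes "k \<in> {1..N}"
  shows "(\<lambda>w. \<Phi> (lam k w) (xi k w)) \<in> borel_measurable P"
  using measurable_compose[OF measurable_Pair[OF lam_measurable[OF assms] xi_measurable[OF assms]]
      \<Phi>_measurable] by simp

text \<open>Freezing \<open>lam k\<close> produces the inner integral of \<open>variance\<close>.
  The nonnegative integral is used because integrability of the error is only derived from this
  bound.\<close>

lemma err_nn_integral:
  assumes k: "k \<in> {1..N}"
  shows "(\<integral>\<^sup>+ w. ennreal ((norm (err k w))\<^sup>2) \<partial>P) \<le> ennreal (\<epsilon> * L * apd_alpha L k / apd_C L k)"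
proof -
  let ?g = "\<lambda>(l, y). ennreal ((norm (gradPhi l y - gradphi l))\<^sup>2)"
  have "?g \<in> borel_measurable (borel \<Otimes>\<^sub>M X)"
  proof -
    note [measurable] = grad_pair_measurable
    have "(\<lambda>z. ennreal ((norm ((\<lambda>(l, y). gradPhi l y) z - gradphi (fst z)))\<^sup>2)) \<in> borel_measurable (borel \<Otimes>\<^sub>M X)"
      by measurable
    then show ?thesis
      by (simp add: case_prod_unfold)
  qed
  from indep_pair_nn_integral[OF indep_lam[OF k] this]
  have "(\<integral>\<^sup>+ w. ennreal ((norm (err k w))\<^sup>2) \<partial>P) =
      (\<integral>\<^sup>+ w. \<integral>\<^sup>+ y. ?g (lam k w, y) \<partial>distr P X (xi k) \<partial>P)"
    by (simp add: err_def grad_def)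
  also have "\<dots> \<le> (\<integral>\<^sup>+ w. ennreal (\<epsilon> * L * apd_alpha L k / apd_C L k) \<partial>P)"
    using variance[OF k] by (intro nn_integral_mono_AE) (simp add: lam_def)
  also have "\<dots> = ennreal (\<epsilon> * L * apd_alpha L k / apd_C L k)"
    by (simp add: emeasure_space_1)
  finally show ?thesis .
qed

text \<open>The factor \<open>apd_C L k / (2 * L)\<close> of the accelerated step cancels against
  the variance bound, leaving a share of \<epsilon>/2 proportional to the step weight.\<close>

lemma err_square_integrable:
  assumes k: "k \<in> {1..N}"
  shows "square_integrable P (err k)"
    and "apd_C L k * expectation (\<lambda>w. (norm (err k w))\<^sup>2) / (2 * L) \<le> \<epsilon> / 2 * apd_alpha L k"
proof -
  obtain j where j: "k = Suc j"
    using k by (cases k) auto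
  have pos: "apd_C L k > 0" "apd_alpha L k > 0"
    unfolding j using apd_C_pos apd_alpha_pos L_pos by auto
  note [measurable] = lam_measurable[OF k] grad_measurable[OF k]
  have [measurable]: "err k \<in> borel_measurable P"
    unfolding err_def[abs_def] by measurable
  have int: "integrable P (\<lambda>w. (norm (err k w))\<^sup>2)"
    using err_nn_integral[OF k] by (intro integrableI_bounded) (auto intro: le_less_trans)
  then show "square_integrable P (err k)"
    by (simp add: square_integrable_def)
  have "expectation (\<lambda>w. (norm (err k w))\<^sup>2) \<le> \<epsilon> * L * apd_alpha L k / apd_C L k"
    using err_nn_integral[OF k] pos \<epsilon>_pos L_pos int
    by (subst (asm) nn_integral_eq_integral) (auto simp: ennreal_le_iff)
  then show "apd_C L k * expectation (\<lambda>w. (norm (err k w))\<^sup>2) / (2 * L) \<le> \<epsilon> / 2 * apd_alpha L k"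
    using pos L_pos by (simp add: field_simps)
qed

section \<open>Second moments, mean-zero noise and integrability along the run\<close>

lemma gradphi_square_integrable:
  assumes "square_integrable P h"
  shows "square_integrable P (\<lambda>w. gradphi (h w))"
proof -
  note [measurable] = square_integrable_measurable[OF assms]
  have "norm (gradphi (h w) - gradphi 0) \<le> norm (L *\<^sub>R h w)" for w
    using lipschitz_onD[OF \<phi>_smooth, of "h w" 0] L_pos by (simp add: dist_norm)
  then have "square_integrable P (\<lambda>w. gradphi (h w) - gradphi 0)"
    by (intro square_integrable_bound[OF square_integrable_scaleR[OF assms, of L]]) measurable
  from square_integrable_add[OF this square_integrable_const[of "gradphi 0"]] show ?thesis
    by simp
qed

lemma lam_grad_square_integrable_Suc:
  assumes "Suc k \<le> N" "square_integrable P (zeta k)" "square_integrable P (eta k)"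
  shows "square_integrable P (lam (Suc k))" "square_integrable P (grad (Suc k))"
proof -
  show lam: "square_integrable P (lam (Suc k))"
    unfolding lam_Suc[abs_def] by (intro square_integrable_add square_integrable_scaleR assms)
  have "square_integrable P (\<lambda>w. err (Suc k) w + gradphi (lam (Suc k) w))"
    using assms(1) by (intro square_integrable_add gradphi_square_integrable lam err_square_integrable) auto
  then show "square_integrable P (grad (Suc k))"
    by (simp add: err_def)
qed

text \<open>The start is deterministic, and each new gradient is a square integrable error plus
  \<open>gradphi\<close> at a square integrable point, where \<open>gradphi\<close> has linear
  growth.\<close>

lemma iterates_square_integrable:
  assumes "k \<le> N"
  shows "square_integrable P (zeta k)" "square_integrable P (eta k)"
proof -
  have "square_integrable P (zeta k) \<and> square_integrable P (eta k)"
    using assms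
  proof (induction k)
    case 0
    then show ?case
      unfolding iterates_0[abs_def] by (simp add: square_integrable_const)
  next
    case (Suc k)
    then have *: "square_integrable P (zeta k)" "square_integrable P (eta k)"
      by auto
    have zeta: "square_integrable P (zeta (Suc k))"
      unfolding zeta_Suc[abs_def]
      by (intro square_integrable_diff square_integrable_scaleR lam_grad_square_integrable_Suc * Suc.prems)
    have "square_integrable P (eta (Suc k))"
      unfolding eta_Suc[abs_def] by (intro square_integrable_add square_integrable_scaleR zeta *)
    with zeta show ?case by simp
  qed
  then show "square_integrable P (zeta k)" "square_integrable P (eta k)"
    by auto
qed

lemma lam_grad_square_integrable:
  assumes "k \<in> {1..N}"
  shows "square_integrable P (lam k)" "square_integrable P (grad k)"
proof -
  obtain j where "k = Suc j" "Suc j \<le> N"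
    using assms by (cases k) auto
  then show "square_integrable P (lam k)" "square_integrable P (grad k)"
    using lam_grad_square_integrable_Suc[of j] iterates_square_integrable[of j] by auto
qed

text \<open>With the state after \<open>k\<close> steps frozen, the second factor is constant and
  the error has mean zero. The pair is frozen because \<open>eta k\<close> is not determined by
  \<open>lam (Suc k)\<close> alone.\<close>

lemma err_orthogonal_history:
  assumes k: "Suc k \<le> N"
  shows "integrable P (\<lambda>w. err (Suc k) w \<bullet> (eta k w - lam (Suc k) w))"
    and "expectation (\<lambda>w. err (Suc k) w \<bullet> (eta k w - lam (Suc k) w)) = 0"
proof -
  have k': "Suc k \<in> {1..N}" using k by simp
  let ?l = "\<lambda>u :: 'h \<times> 'h. apd_tau L (Suc k) *\<^sub>R fst u + (1 - apd_tau L (Suc k)) *\<^sub>R snd u"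
  let ?g = "\<lambda>(u, y). (gradPhi (?l u) y - gradphi (?l u)) \<bullet> (snd u - ?l u)"
  show int: "integrable P (\<lambda>w. err (Suc k) w \<bullet> (eta k w - lam (Suc k) w))"
    using k iterates_square_integrable[of k]
    by (intro square_integrable_inner square_integrable_diff lam_grad_square_integrable err_square_integrable) auto
  have eq: "(\<lambda>w. ?g ((zeta k w, eta k w), xi (Suc k) w)) = (\<lambda>w. err (Suc k) w \<bullet> (eta k w - lam (Suc k) w))"
    by (simp add: err_def grad_def lam_Suc)
  have meas: "?g \<in> borel_measurable ((borel \<Otimes>\<^sub>M borel) \<Otimes>\<^sub>M X)"
  proof -
    have l[measurable]: "?l \<in> borel \<Otimes>\<^sub>M borel \<rightarrow>\<^sub>M borel"
      by measurable
    have [measurable]: "(\<lambda>z. gradPhi (?l (fst z)) (snd z)) \<in> borel_measurable ((borel \<Otimes>\<^sub>M borel) \<Otimes>\<^sub>M X)"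
      using measurable_compose[OF measurable_Pair grad_pair_measurable,
          of "\<lambda>z. ?l (fst z)" "(borel \<Otimes>\<^sub>M borel) \<Otimes>\<^sub>M X" snd] measurable_compose[OF measurable_fst l]
      by simp
    have "(\<lambda>z. (gradPhi (?l (fst z)) (snd z) - gradphi (?l (fst z))) \<bullet> (snd (fst z) - ?l (fst z)))
        \<in> borel_measurable ((borel \<Otimes>\<^sub>M borel) \<Otimes>\<^sub>M X)"
      by measurable
    then show ?thesis
      by (simp add: case_prod_unfold)
  qed
  have zero: "expectation (\<lambda>w. ?g (u, xi (Suc k) w)) = 0" for u
    using grad_unbiased[OF k', of "?l u"]
    by (simp add: has_bochner_integral_iff prob_space)
  have "expectation (\<lambda>w. ?g ((zeta k w, eta k w), xi (Suc k) w)) = expectation (\<lambda>w. 0)"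
    by (rule indep_pair_integral[OF indep_history[OF k] meas]) (use int zero in \<open>simp_all only: eq\<close>)
  then show "expectation (\<lambda>w. err (Suc k) w \<bullet> (eta k w - lam (Suc k) w)) = 0"
    unfolding eq by simp
qed

text \<open>The sample subgradient inequality at \<open>xi 1\<close>, integrated;
  \<open>N_pos\<close> ensures that this sample exists.\<close>

lemma \<phi>_subgradient: "\<phi> m \<ge> \<phi> l + gradphi l \<bullet> (m - l)"
proof -
  have 1: "1 \<in> {1..N}" using N_pos by simp
  have "has_bochner_integral P (\<lambda>w. \<Phi> l (xi 1 w) + gradPhi l (xi 1 w) \<bullet> (m - l)) (\<phi> l + gradphi l \<bullet> (m - l))"
    by (intro has_bochner_integral_add has_bochner_integral_inner_left \<Phi>_unbiased[OF 1] grad_unbiased[OF 1])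
  then have eq: "\<phi> l + gradphi l \<bullet> (m - l) = expectation (\<lambda>w. \<Phi> l (xi 1 w) + gradPhi l (xi 1 w) \<bullet> (m - l))"
    and int: "integrable P (\<lambda>w. \<Phi> l (xi 1 w) + gradPhi l (xi 1 w) \<bullet> (m - l))"
    by (simp_all only: has_bochner_integral_iff)
  have "expectation (\<lambda>w. \<Phi> l (xi 1 w) + gradPhi l (xi 1 w) \<bullet> (m - l)) \<le> expectation (\<lambda>w. \<Phi> m (xi 1 w))"
    using \<Phi>_unbiased[OF 1, of m] int
    by (intro integral_mono \<Phi>_subgradient measurable_space[OF xi_measurable[OF 1]])
      (simp_all only: has_bochner_integral_iff)
  also have "\<dots> = \<phi> m"
    using \<Phi>_unbiased[OF 1, of m] by (simp only: has_bochner_integral_iff)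
  finally show ?thesis
    by (simp only: eq)
qed

text \<open>The subgradient inequalities at \<open>0\<close> and at \<open>lam k w\<close> enclose
  the value between integrable functions.\<close>

lemma \<phi>_lam_integrable:
  assumes k: "k \<in> {1..N}"
  shows "integrable P (\<lambda>w. \<phi> (lam k w))"
proof (rule Bochner_Integration.integrable_bound)
  note [measurable] = lam_measurable[OF k]
  show "integrable P (\<lambda>w. \<bar>\<phi> 0\<bar> + \<bar>gradphi 0 \<bullet> lam k w\<bar> + \<bar>gradphi (lam k w) \<bullet> lam k w\<bar>)"
    by (intro Bochner_Integration.integrable_add integrable_abs integrable_const square_integrable_inner
        square_integrable_const gradphi_square_integrable lam_grad_square_integrable k)
  show "(\<lambda>w. \<phi> (lam k w)) \<in> borel_measurable P"
    by measurable
  show "AE w in P. norm (\<phi> (lam k w)) \<le>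
      norm (\<bar>\<phi> 0\<bar> + \<bar>gradphi 0 \<bullet> lam k w\<bar> + \<bar>gradphi (lam k w) \<bullet> lam k w\<bar>)"
  proof (rule AE_I2)
    fix w
    have "\<phi> 0 + gradphi 0 \<bullet> lam k w \<le> \<phi> (lam k w)" "\<phi> (lam k w) - gradphi (lam k w) \<bullet> lam k w \<le> \<phi> 0"
      using \<phi>_subgradient[of 0 "lam k w"] \<phi>_subgradient[of "lam k w" 0] by simp_all
    then show "norm (\<phi> (lam k w)) \<le>
        norm (\<bar>\<phi> 0\<bar> + \<bar>gradphi 0 \<bullet> lam k w\<bar> + \<bar>gradphi (lam k w) \<bullet> lam k w\<bar>)"
      unfolding real_norm_def by linarith
  qed
qed

lemma \<Phi>_lam_integrable:
  assumes k: "k \<in> {1..N}"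
  shows "integrable P (\<lambda>w. \<Phi> (lam k w) (xi k w))"
proof (rule Bochner_Integration.integrable_bound)
  have grad0: "(\<lambda>y. norm (gradPhi 0 y)) \<in> borel_measurable X"
    using measurable_compose[OF measurable_Pair1' grad_pair_measurable, of 0] by simp
  \<comment> \<open>The gradient at \<open>0\<close> is known to be integrable but not square
    integrable, so independence from \<open>lam k\<close> is what makes the product
    integrable.\<close>
  have "indep_var borel (norm \<circ> lam k) borel ((\<lambda>y. norm (gradPhi 0 y)) \<circ> xi k)"
    unfolding indep_pair_iff_indep_var[symmetric]
    by (rule indep_pair_compose[OF indep_lam[OF k]]) (use grad0 in simp_all)
  then have prod: "integrable P (\<lambda>w. norm (lam k w) * norm (gradPhi 0 (xi k w)))"
    using indep_var_integrable[of "norm \<circ> lam k" "(\<lambda>y. norm (gradPhi 0 y)) \<circ> xi k"]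
      square_integrable_integrable[OF lam_grad_square_integrable(1)[OF k]] grad_unbiased[OF k, of 0]
    by (simp add: has_bochner_integral_iff comp_def)
  then show "integrable P (\<lambda>w. \<bar>\<Phi> 0 (xi k w)\<bar> + norm (lam k w) * norm (gradPhi 0 (xi k w)) + \<bar>grad k w \<bullet> lam k w\<bar>)"
    using \<Phi>_unbiased[OF k, of 0]
    by (intro Bochner_Integration.integrable_add integrable_abs square_integrable_inner
        lam_grad_square_integrable k) (auto simp: has_bochner_integral_iff)
  show "(\<lambda>w. \<Phi> (lam k w) (xi k w)) \<in> borel_measurable P"
    by (rule \<Phi>_lam_measurable[OF k])
  show "AE w in P. norm (\<Phi> (lam k w) (xi k w)) \<le>
      norm (\<bar>\<Phi> 0 (xi k w)\<bar> + norm (lam k w) * norm (gradPhi 0 (xi k w)) + \<bar>grad k w \<bullet> lam k w\<bar>)"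
  proof (rule AE_I2)
    fix w assume "w \<in> space P"
    then have y: "xi k w \<in> space X"
      by (rule measurable_space[OF xi_measurable[OF k]])
    have "\<Phi> 0 (xi k w) + gradPhi 0 (xi k w) \<bullet> lam k w \<le> \<Phi> (lam k w) (xi k w)"
      "\<Phi> (lam k w) (xi k w) - grad k w \<bullet> lam k w \<le> \<Phi> 0 (xi k w)"
      using \<Phi>_subgradient[OF y, of 0 "lam k w"] \<Phi>_subgradient[OF y, of "lam k w" 0]
      by (simp_all add: grad_def)
    moreover have "\<bar>gradPhi 0 (xi k w) \<bullet> lam k w\<bar> \<le> norm (lam k w) * norm (gradPhi 0 (xi k w))"
      using Cauchy_Schwarz_ineq2[of "gradPhi 0 (xi k w)" "lam k w"] by (simp add: mult.commute)
    ultimately show "norm (\<Phi> (lam k w) (xi k w)) \<le>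
        norm (\<bar>\<Phi> 0 (xi k w)\<bar> + norm (lam k w) * norm (gradPhi 0 (xi k w)) + \<bar>grad k w \<bullet> lam k w\<bar>)"
      unfolding real_norm_def by linarith
  qed
qed

lemma \<Phi>_lam_expectation:
  assumes k: "k \<in> {1..N}"
  shows "expectation (\<lambda>w. \<Phi> (lam k w) (xi k w)) = expectation (\<lambda>w. \<phi> (lam k w))"
  using indep_pair_integral[OF indep_lam[OF k] \<Phi>_measurable, of \<phi>] \<Phi>_lam_integrable[OF k] \<Phi>_unbiased[OF k]
  by (simp add: has_bochner_integral_iff)

text \<open>\<open>accelerated_step\<close> telescoped. The initial potential is half the squared
  norm of \<open>u\<close>, since \<open>apd_C L 0\<close> and \<open>zeta 0 w\<close>
  vanish.\<close>

lemma accelerated_pathwise_bound: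
  "apd_C L n * \<phi> (eta n w) + (norm (zeta n w - u))\<^sup>2 / 2 \<le> (norm u)\<^sup>2 / 2
    + (\<Sum>k<n. apd_alpha L (Suc k) * (\<phi> (lam (Suc k) w) + grad (Suc k) w \<bullet> (u - lam (Suc k) w))
        + apd_C L k * (err (Suc k) w \<bullet> (eta k w - lam (Suc k) w))
        + apd_C L (Suc k) * (norm (err (Suc k) w))\<^sup>2 / (2 * L))"
proof (induction n)
  case 0
  then show ?case by (simp add: iterates_0)
next
  case (Suc n)
  have "apd_C L (Suc n) * \<phi> (eta (Suc n) w) + (norm (zeta (Suc n) w - u))\<^sup>2 / 2
      \<le> apd_C L n * \<phi> (eta n w) + (norm (zeta n w - u))\<^sup>2 / 2
      + apd_alpha L (Suc n) * (\<phi> (lam (Suc n) w) + grad (Suc n) w \<bullet> (u - lam (Suc n) w))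
      + apd_C L n * (err (Suc n) w \<bullet> (eta n w - lam (Suc n) w))
      + apd_C L (Suc n) * (norm (err (Suc n) w))\<^sup>2 / (2 * L)"
    unfolding err_def
    by (rule accelerated_step[OF apd_C_nonneg[OF L_pos] apd_alpha_pos[OF L_pos] L_pos apd_C_Suc apd_C_eq[OF L_pos]
          lam_Suc[unfolded apd_tau_def] zeta_Suc eta_Suc[unfolded apd_tau_def]
          \<phi>_subgradient descent_lemma[OF \<phi>_grad \<phi>_smooth]])
  with Suc show ?case
    by (simp del: apd_C.simps apd_alpha.simps)
qed

text \<open>Built from \<Phi> rather than \<phi>: the sample values can be compared with
  \<open>Fstar\<close> pointwise, and the means agree.\<close>

definition "linear_model u w =
  (\<Sum>k=1..N. apd_alpha L k * (\<Phi> (lam k w) (xi k w) + grad k w \<bullet> (u - lam k w)))"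

text \<open>Replacing \<open>\<phi> (eta N w)\<close> by a lower bound before integrating leaves a
  constant on the left, so only the right-hand terms need integrability. The point \<open>u\<close>
  is deterministic.\<close>

lemma linear_model_bound:
  assumes min: "\<And>l. \<phi>min \<le> \<phi> l"
  shows "integrable P (linear_model u)"
    and "apd_C L N * \<phi>min \<le> expectation (linear_model u) + (norm u)\<^sup>2 / 2 + apd_C L N * (\<epsilon> / 2)"
proof -
  have u_lam: "square_integrable P (\<lambda>w. u - lam k w)" if "k \<in> {1..N}" for k
    by (intro square_integrable_diff square_integrable_const lam_grad_square_integrable that)
  have int_grad: "integrable P (\<lambda>w. grad k w \<bullet> (u - lam k w))" if "k \<in> {1..N}" for k
    by (intro square_integrable_inner u_lam lam_grad_square_integrable that)
  show "integrable P (linear_model u)"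
    unfolding linear_model_def[abs_def] using int_grad \<Phi>_lam_integrable by auto
  have shift: "linear_model u w = (\<Sum>k<N. apd_alpha L (Suc k)
      * (\<Phi> (lam (Suc k) w) (xi (Suc k) w) + grad (Suc k) w \<bullet> (u - lam (Suc k) w)))" for w
    by (simp only: linear_model_def One_nat_def sum.atLeast1_atMost_eq)
  \<comment> \<open>The terms \<open>a\<close>, \<open>q\<close> and \<open>v\<close> are the linear
    model, the mean-zero noise and the quadratic noise.\<close>
  define a where "a k w = apd_alpha L (Suc k) * (\<phi> (lam (Suc k) w) + grad (Suc k) w \<bullet> (u - lam (Suc k) w))" for k w
  define q where "q k w = apd_C L k * (err (Suc k) w \<bullet> (eta k w - lam (Suc k) w))" for k w
  define v where "v k w = apd_C L (Suc k) * (norm (err (Suc k) w))\<^sup>2 / (2 * L)" for k w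
  have a: "integrable P (a k)" "expectation (a k) = expectation (\<lambda>w. apd_alpha L (Suc k)
      * (\<Phi> (lam (Suc k) w) (xi (Suc k) w) + grad (Suc k) w \<bullet> (u - lam (Suc k) w)))" if "k < N" for k
    using that \<phi>_lam_integrable[of "Suc k"] \<Phi>_lam_integrable[of "Suc k"] \<Phi>_lam_expectation[of "Suc k"]
      int_grad[of "Suc k"] unfolding a_def by (auto simp del: apd_alpha.simps)
  have q: "integrable P (q k)" "expectation (q k) = 0" if "k < N" for k
    using that err_orthogonal_history[of k] unfolding q_def by auto
  have v: "integrable P (v k)" "expectation (v k) \<le> \<epsilon> / 2 * apd_alpha L (Suc k)" if "k < N" for k
    using that err_square_integrable[of "Suc k"] unfolding v_def square_integrable_def
    by (auto simp del: apd_alpha.simps apd_C.simps)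
  have le: "apd_C L N * \<phi>min \<le> (norm u)\<^sup>2 / 2 + (\<Sum>k<N. a k w + q k w + v k w)" for w
  proof -
    have "apd_C L N * \<phi>min \<le> apd_C L N * \<phi> (eta N w) + (norm (zeta N w - u))\<^sup>2 / 2"
      using mult_left_mono[OF min[of "eta N w"] apd_C_nonneg[OF L_pos, of N]] by (simp add: add_increasing2)
    then show ?thesis
      using accelerated_pathwise_bound[of N w u] unfolding a_def q_def v_def by linarith
  qed
  have sum: "has_bochner_integral P (\<lambda>w. \<Sum>k<N. a k w + q k w + v k w)
      (\<Sum>k<N. expectation (a k) + expectation (q k) + expectation (v k))"
    using a q v by (intro has_bochner_integral_sum has_bochner_integral_add has_bochner_integral_integrable) auto
  have "has_bochner_integral P (\<lambda>w. (norm u)\<^sup>2 / 2) ((norm u)\<^sup>2 / 2)"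
    by (simp add: has_bochner_integral_iff prob_space)
  from has_bochner_integral_add[OF this sum]
  have "integrable P (\<lambda>w. (norm u)\<^sup>2 / 2 + (\<Sum>k<N. a k w + q k w + v k w))"
    and eq: "expectation (\<lambda>w. (norm u)\<^sup>2 / 2 + (\<Sum>k<N. a k w + q k w + v k w)) =
      (norm u)\<^sup>2 / 2 + (\<Sum>k<N. expectation (a k) + expectation (q k) + expectation (v k))"
    by (simp_all only: has_bochner_integral_iff)
  then have "expectation (\<lambda>w. apd_C L N * \<phi>min) \<le>
      expectation (\<lambda>w. (norm u)\<^sup>2 / 2 + (\<Sum>k<N. a k w + q k w + v k w))"
    using le by (intro integral_mono integrable_const)
  also note eq
  also have "(\<Sum>k<N. expectation (a k) + expectation (q k) + expectation (v k))
      \<le> (\<Sum>k<N. expectation (a k) + \<epsilon> / 2 * apd_alpha L (Suc k))"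
    using q v by (intro sum_mono) (simp del: apd_alpha.simps)
  also have "\<dots> = expectation (linear_model u) + \<epsilon> / 2 * apd_C L N"
  proof -
    have "expectation (linear_model u) = (\<Sum>k<N. expectation (a k))"
      unfolding shift[abs_def] using a(2) \<Phi>_lam_integrable int_grad
      by (simp add: Bochner_Integration.integral_sum del: apd_alpha.simps)
    moreover have "apd_C L N = (\<Sum>k<N. apd_alpha L (Suc k))"
      by (simp only: apd_C_sum One_nat_def sum.atLeast1_atMost_eq)
    ultimately show ?thesis
      by (simp add: sum.distrib sum_distrib_left del: apd_alpha.simps)
  qed
  finally show "apd_C L N * \<phi>min \<le> expectation (linear_model u) + (norm u)\<^sup>2 / 2 + apd_C L N * (\<epsilon> / 2)"
    by (simp add: prob_space mult.commute)
qed

end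

section \<open>Primal bounds from the expected dual estimate\<close>

theorem theorem3p5:
  fixes Q :: "'e::euclidean_space set"
    and f :: "'e \<Rightarrow> real"
    and A :: "'e \<Rightarrow> 'h::euclidean_space"
    and b :: 'h
    and P :: "'w measure"
    and X :: "'x measure"
    and xi :: "nat \<Rightarrow> 'w \<Rightarrow> 'x"
    and Fstar :: "'e \<Rightarrow> 'x \<Rightarrow> ereal"
    and xsol :: "'h \<Rightarrow> 'x \<Rightarrow> 'e"
    and gradphi :: "'h \<Rightarrow> 'h"
    and lamstar :: 'h
    and x0 :: 'e
    and L R \<epsilon> :: real
    and N :: nat
  defines "\<phi> \<equiv> dual_objective Q f A b"
    and "F \<equiv> sample_primal Fstar"
    and "\<Phi> \<equiv> stoch_dual Fstar A b"
    and "gradPhi \<equiv> stoch_grad xsol A b"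
    and "lam \<equiv> (\<lambda>k w. apd_lambda L xsol A b x0 (\<lambda>j. xi j w) k)"
    and "xhat \<equiv> (\<lambda>k w. apd_xhat L xsol A b x0 (\<lambda>j. xi j w) k)"
  assumes "closed Q" and "convex Q"
    and "convex_on Q f" and "closed (epigraph Q f)"
    and "linear A"
    and dual_max_attained:
      "\<And>l. \<exists>x. is_arg_max (\<lambda>x. - f x - adjoint A l \<bullet> x) (\<lambda>x. x \<in> Q) x"
    and "prob_space P"
    and fresh: "prob_space.indep_vars P (\<lambda>_. X) xi {1..N}"
    and Fstar_meas: "(\<lambda>(s, y). Fstar s y) \<in> borel_measurable (borel \<Otimes>\<^sub>M X)"
    and xsol_meas: "(\<lambda>(l, y). xsol l y) \<in> borel_measurable (borel \<Otimes>\<^sub>M X)"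
    and conj_expectation:
      "\<And>k s. k \<in> {1..N} \<Longrightarrow>
         fenchel_conjugate Q (\<lambda>x. ereal (f x)) s = ereal_expectation P (\<lambda>w. Fstar s (xi k w))"
    and Fstar_finite: "\<And>l y. y \<in> space X \<Longrightarrow> \<bar>Fstar (- adjoint A l) y\<bar> \<noteq> \<infinity>"
    and Fstar_conj:
      "\<And>l y. y \<in> space X \<Longrightarrow>
         Fstar (- adjoint A l) y = fenchel_conjugate Q (\<lambda>x. F x y) (- adjoint A l)"
    and xsol_argmax:
      "\<And>l y. y \<in> space X \<Longrightarrow>
         is_arg_max (\<lambda>x. ereal (- adjoint A l \<bullet> x) - F x y) (\<lambda>x. x \<in> Q) (xsol l y)"
    and Phi_grad: "\<And>l y. y \<in> space X \<Longrightarrow> GDERIV (\<lambda>m. \<Phi> m y) l :> gradPhi l y"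
    and Phi_unbiased:
      "\<And>k l. k \<in> {1..N} \<Longrightarrow> has_bochner_integral P (\<lambda>w. \<Phi> l (xi k w)) (\<phi> l)"
    and gradPhi_unbiased:
      "\<And>k l. k \<in> {1..N} \<Longrightarrow> has_bochner_integral P (\<lambda>w. gradPhi l (xi k w)) (gradphi l)"
    and phi_grad: "\<And>l. GDERIV \<phi> l :> gradphi l"
    and phi_smooth: "lipschitz_on L UNIV gradphi"
    and "L > 0"
    and dual_solution: "is_arg_min \<phi> (\<lambda>_. True) lamstar"
    and "norm lamstar \<le> R" and "R > 0"
    and "\<epsilon> > 0" and "N \<ge> 1"
    and variance:
      "\<And>k. k \<in> {1..N} \<Longrightarrow>
         AE w in P. (\<integral>\<^sup>+ y. ennreal ((norm (gradPhi (lam k w) y - gradphi (lam k w)))\<^sup>2)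
                       \<partial>(distr P X (xi k)))
                    \<le> ennreal (\<epsilon> * L * apd_alpha L k / apd_C L k)"
    and xhat_integrable: "integrable P (xhat N)"
  shows "f (\<integral>w. xhat N w \<partial>P) - primal_value Q f A b
           \<le> 32 * L * R\<^sup>2 / (real N)\<^sup>2 + \<epsilon> / 2
       \<and> norm (A (\<integral>w. xhat N w \<partial>P) - b)
           \<le> 32 * L * R / (real N)\<^sup>2 + \<epsilon> / (2 * R)"
proof -
  interpret prob_space P by fact
  have adj: "adjoint A l \<bullet> x = l \<bullet> A x" for l x
    by (simp add: adjoint_clauses[OF \<open>linear A\<close>])
  have A_bl: "bounded_linear A"
    using \<open>linear A\<close> by (simp add: linear_conv_bounded_linear)
  have \<Phi>_meas: "(\<lambda>(l, y). \<Phi> l y) \<in> borel_measurable (borel \<Otimes>\<^sub>M X)"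
  proof -
    note [measurable] = linear_borel_measurable[OF adjoint_linear[OF \<open>linear A\<close>]]
    have [measurable]: "(\<lambda>z. Fstar (- adjoint A (fst z)) (snd z)) \<in> borel_measurable (borel \<Otimes>\<^sub>M X)"
      using measurable_compose[OF measurable_Pair Fstar_meas,
          of "\<lambda>z. - adjoint A (fst z)" "borel \<Otimes>\<^sub>M X" snd] by simp
    have "(\<lambda>z. fst z \<bullet> b + real_of_ereal (Fstar (- adjoint A (fst z)) (snd z))) \<in> borel_measurable (borel \<Otimes>\<^sub>M X)"
      by measurable
    then show ?thesis
      by (simp add: \<Phi>_def stoch_dual_def case_prod_unfold)
  qed
  \<comment> \<open>The slope \<open>s\<close> may lie outside the range of
    \<open>adjoint A\<close>; the slope supplied later by separation is of this general
    kind.\<close>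
  have sample_subgradient: "real_of_ereal (Fstar s y)
      \<ge> real_of_ereal (Fstar (- adjoint A l) y) + s \<bullet> xsol l y + l \<bullet> A (xsol l y)"
    if "y \<in> space X" "\<bar>Fstar s y\<bar> \<noteq> \<infinity>" for s l y
    using sample_primal_arg_max_subgradient[OF Fstar_finite[OF that(1), of l] that(2)
        Fstar_conj[OF that(1), unfolded F_def] xsol_argmax[OF that(1), unfolded F_def]]
    by (simp add: inner_add_left adj)
  have \<Phi>_sub: "\<Phi> m y \<ge> \<Phi> l y + stoch_grad xsol A b l y \<bullet> (m - l)" if "y \<in> space X" for l m y
    using sample_subgradient[OF that Fstar_finite[OF that, of m], of l]
    by (simp add: \<Phi>_def stoch_dual_def stoch_grad_def adj inner_diff inner_commute)
  interpret M: stochastic_dual_method P X xi A b xsol \<phi> gradphi \<Phi> x0 L \<epsilon> N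
    by (intro stochastic_dual_method.intro stochastic_dual_method_axioms.intro
        \<open>prob_space P\<close> \<open>linear A\<close> fresh xsol_meas \<Phi>_meas \<Phi>_sub Phi_unbiased
        gradPhi_unbiased[unfolded gradPhi_def] phi_grad phi_smooth \<open>L > 0\<close> \<open>\<epsilon> > 0\<close> \<open>N \<ge> 1\<close>
        variance[unfolded gradPhi_def lam_def])
  define C where "C = apd_C L N"
  have C: "C \<ge> (real N)\<^sup>2 / (8 * L)"
    unfolding C_def by (rule apd_C_ge[OF \<open>L > 0\<close>])
  moreover have "(real N)\<^sup>2 / (8 * L) > 0"
    using \<open>L > 0\<close> \<open>N \<ge> 1\<close> by simp
  ultimately have C_pos: "C > 0" by linarith
  define x where "x k w = xsol (M.lam k w) (xi k w)" for k w
  define xbar where "xbar = (\<integral>w. xhat N w \<partial>P)"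
  have xhat_sum: "C *\<^sub>R xhat N w = (\<Sum>k=1..N. apd_alpha L k *\<^sub>R x k w)" for w
    unfolding C_def xhat_def x_def M.lam_def by (rule apd_xhat_sum[OF \<open>L > 0\<close>])
  have xi_space: "xi k w \<in> space X" if "k \<in> {1..N}" "w \<in> space P" for k w
    using measurable_space[OF M.xi_measurable] that by blast
  have "xhat N w \<in> Q" if "w \<in> space P" for w
  proof -
    obtain n where n: "N = Suc n"
      using \<open>N \<ge> 1\<close> by (cases N) auto
    show ?thesis
      unfolding xhat_def n
    proof (rule apd_xhat_in_convex[OF \<open>L > 0\<close> \<open>convex Q\<close>])
      fix k assume "k \<in> {1..Suc n}"
      then show "xsol (apd_lambda L xsol A b x0 (\<lambda>j. xi j w) k) (xi k w) \<in> Q"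
        using xsol_argmax[OF xi_space[of k w]] that n by (auto simp: is_arg_max_def)
    qed
  qed
  then have xbar_Q: "xbar \<in> Q"
    unfolding xbar_def by (intro expectation_in_closed_convex \<open>closed Q\<close> \<open>convex Q\<close> xhat_integrable)
  have \<phi>_min: "\<phi> lamstar \<le> \<phi> l" for l
    using dual_solution by (auto simp: is_arg_min_def not_less)
  have \<phi>_ge: "\<phi> l \<ge> l \<bullet> (b - A z) - f z" if "z \<in> Q" for l z
    using dual_max_attained[of l] dual_objective_ge[where f = f and l = l and b = b, OF _ \<open>linear A\<close> that] unfolding \<phi>_def by blast

  \<comment> \<open>Arguing with every \<open>t\<close> below \<open>f xbar\<close> avoids a
    subgradient of \<open>f\<close> at \<open>xbar\<close>, which may fail to exist on the boundary
    of \<open>Q\<close>.\<close>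
  have gap: "f xbar \<le> (b - A xbar) \<bullet> u + (norm u)\<^sup>2 / (2 * C) + \<epsilon> / 2 - \<phi> lamstar" for u
  proof (rule dense_le)
    fix t assume "t < f xbar"
    then obtain s where s: "\<And>z. z \<in> Q \<Longrightarrow> s \<bullet> z - f z \<le> s \<bullet> xbar - t"
      using convex_conjugate_minorant[OF \<open>convex_on Q f\<close> \<open>closed (epigraph Q f)\<close> xbar_Q] by blast
    have up: "fenchel_conjugate Q (\<lambda>x. ereal (f x)) s \<le> ereal (s \<bullet> xbar - t)"
      unfolding fenchel_conjugate_def by (rule SUP_least) (use s in simp)
    have low: "ereal (s \<bullet> xbar - f xbar) \<le> fenchel_conjugate Q (\<lambda>x. ereal (f x)) s"
      unfolding fenchel_conjugate_def by (rule SUP_upper2[OF xbar_Q]) simp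
    \<comment> \<open>Finiteness of the conjugate at \<open>s\<close> is what makes
      \<open>Fstar s (xi k w)\<close> integrable and almost surely finite.\<close>
    obtain c where c: "fenchel_conjugate Q (\<lambda>x. ereal (f x)) s = ereal c"
      using up low by (cases "fenchel_conjugate Q (\<lambda>x. ereal (f x)) s") auto
    have c_le: "c \<le> s \<bullet> xbar - t"
      using up by (simp add: c)
    have Fs: "AE w in P. \<bar>Fstar s (xi k w)\<bar> \<noteq> \<infinity>"
        "has_bochner_integral P (\<lambda>w. real_of_ereal (Fstar s (xi k w))) c" if k: "k \<in> {1..N}" for k
    proof -
      have "(\<lambda>w. Fstar s (xi k w)) \<in> borel_measurable P"
        using measurable_compose[OF measurable_Pair[OF measurable_const M.xi_measurable[OF k]] Fstar_meas, of s]
        by simp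
      from ereal_expectation_finite[OF this, of c] show "AE w in P. \<bar>Fstar s (xi k w)\<bar> \<noteq> \<infinity>"
        "has_bochner_integral P (\<lambda>w. real_of_ereal (Fstar s (xi k w))) c"
        using trans[OF conj_expectation[OF k, of s, symmetric] c] by simp_all
    qed
    \<comment> \<open>In the sample subgradient inequality all terms in \<open>M.lam k w\<close>
      cancel. What remains is affine in \<open>xhat N w\<close> apart from \<open>Fstar\<close> at
      the fixed slope \<open>s\<close>, so its mean is explicit.\<close>
    define B where "B w = (\<Sum>k=1..N. apd_alpha L k * real_of_ereal (Fstar s (xi k w)))
      + C * ((b - A (xhat N w)) \<bullet> u - s \<bullet> xhat N w)" for w
    have "AE w in P. M.linear_model u w \<le> B w"
    proof -
      have "AE w in P. \<forall>k\<in>{1..N}. \<bar>Fstar s (xi k w)\<bar> \<noteq> \<infinity>"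
        using Fs(1) by (intro AE_finite_allI) auto
      then show ?thesis
        using AE_space
      proof eventually_elim
        case (elim w)
        have "M.linear_model u w \<le> (\<Sum>k=1..N. apd_alpha L k *
            (real_of_ereal (Fstar s (xi k w)) + ((b - A (x k w)) \<bullet> u - s \<bullet> x k w)))"
          unfolding M.linear_model_def
        proof (intro sum_mono mult_left_mono)
          fix k assume k: "k \<in> {1..N}"
          show "\<Phi> (M.lam k w) (xi k w) + M.grad k w \<bullet> (u - M.lam k w)
              \<le> real_of_ereal (Fstar s (xi k w)) + ((b - A (x k w)) \<bullet> u - s \<bullet> x k w)"
            using sample_subgradient[OF xi_space[OF k elim(2)] bspec[OF elim(1) k], of "M.lam k w"]
            by (simp add: \<Phi>_def stoch_dual_def M.grad_def stoch_grad_def x_def inner_diff inner_commute)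
          show "0 \<le> apd_alpha L k"
            using apd_alpha_pos[OF \<open>L > 0\<close>, of "k - 1"] k by (simp del: apd_alpha.simps)
        qed
        also have "\<dots> = (\<Sum>k=1..N. apd_alpha L k * real_of_ereal (Fstar s (xi k w)))
            + ((\<Sum>k=1..N. apd_alpha L k *\<^sub>R (b - A (x k w))) \<bullet> u - s \<bullet> (\<Sum>k=1..N. apd_alpha L k *\<^sub>R x k w))"
          by (simp add: inner_sum_left inner_sum_right sum.distrib[symmetric] sum_subtractf[symmetric] algebra_simps)
        also have "(\<Sum>k=1..N. apd_alpha L k *\<^sub>R (b - A (x k w))) = C *\<^sub>R (b - A (xhat N w))"
        proof -
          have "C *\<^sub>R A (xhat N w) = A (\<Sum>k=1..N. apd_alpha L k *\<^sub>R x k w)"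
            unfolding xhat_sum[symmetric] by (simp add: linear_cmul[OF \<open>linear A\<close>])
          also have "\<dots> = (\<Sum>k=1..N. apd_alpha L k *\<^sub>R A (x k w))"
            by (simp add: linear_sum[OF \<open>linear A\<close>] linear_cmul[OF \<open>linear A\<close>])
          finally show ?thesis
            by (simp add: C_def apd_C_sum scaleR_diff_right sum_subtractf scaleR_sum_left)
        qed
        also have "(\<Sum>k=1..N. apd_alpha L k *\<^sub>R x k w) = C *\<^sub>R xhat N w"
          by (simp only: xhat_sum)
        finally show ?case
          by (simp add: B_def right_diff_distrib)
      qed
    qed
    moreover have B: "has_bochner_integral P B (C * c + C * ((b - A xbar) \<bullet> u - s \<bullet> xbar))"
    proof -
      have xb: "has_bochner_integral P (xhat N) xbar"
        unfolding xbar_def by (rule has_bochner_integral_integrable[OF xhat_integrable])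
      have const: "has_bochner_integral P (\<lambda>_. b) b"
        by (simp add: has_bochner_integral_iff prob_space)
      have Fs_sum: "has_bochner_integral P (\<lambda>w. \<Sum>k=1..N. apd_alpha L k * real_of_ereal (Fstar s (xi k w)))
          (\<Sum>k=1..N. apd_alpha L k * c)"
        by (intro has_bochner_integral_sum has_bochner_integral_mult_right Fs)
      have C_c: "(\<Sum>k=1..N. apd_alpha L k * c) = C * c"
        by (simp add: C_def apd_C_sum sum_distrib_right)
      have "has_bochner_integral P (\<lambda>w. C * ((b - A (xhat N w)) \<bullet> u - s \<bullet> xhat N w))
          (C * ((b - A xbar) \<bullet> u - s \<bullet> xbar))"
        by (intro has_bochner_integral_mult_right has_bochner_integral_diff has_bochner_integral_inner_left
            has_bochner_integral_inner_right const xb has_bochner_integral_bounded_linear[OF A_bl])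
      from has_bochner_integral_add[OF Fs_sum this] show ?thesis
        unfolding B_def[abs_def] C_c .
    qed
    ultimately have "expectation (M.linear_model u) \<le> C * c + C * ((b - A xbar) \<bullet> u - s \<bullet> xbar)"
      using integral_mono_AE[OF M.linear_model_bound(1)[OF \<phi>_min, of u], of B]
      by (simp add: has_bochner_integral_iff)
    also have "\<dots> \<le> C * ((b - A xbar) \<bullet> u - t)"
      using c_le C_pos by (simp add: distrib_left[symmetric])
    finally have "C * \<phi> lamstar \<le> C * ((b - A xbar) \<bullet> u - t) + (norm u)\<^sup>2 / 2 + C * (\<epsilon> / 2)"
      using M.linear_model_bound(2)[OF \<phi>_min, of u] by (simp add: C_def)
    also have "\<dots> = C * ((b - A xbar) \<bullet> u - t + (norm u)\<^sup>2 / (2 * C) + \<epsilon> / 2)"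
      using C_pos by (simp add: field_simps)
    finally show "t \<le> (b - A xbar) \<bullet> u + (norm u)\<^sup>2 / (2 * C) + \<epsilon> / 2 - \<phi> lamstar"
      using C_pos by simp
  qed

  \<comment> \<open>The dual maximizer at \<open>lamstar\<close> is feasible: \<open>b - A z\<close>
    is a subgradient of \<phi> there, hence its gradient, which is zero at a minimum. A feasible
    point is needed because the infimum in \<open>primal_value\<close> is a real one.\<close>
  obtain z where z: "is_arg_max (\<lambda>x. - f x - adjoint A lamstar \<bullet> x) (\<lambda>x. x \<in> Q) z"
    using dual_max_attained by blast
  then have z_Q: "z \<in> Q"
    by (simp add: is_arg_max_def)
  have "\<phi> m \<ge> \<phi> lamstar + (b - A z) \<bullet> (m - lamstar)" for m
    using \<phi>_ge[OF z_Q, of m] dual_objective_attained[OF z \<open>linear A\<close>, of b]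
    unfolding \<phi>_def by (simp add: inner_diff inner_commute)
  then have "b - A z = gradphi lamstar"
    by (rule GDERIV_subgradient_unique[OF phi_grad])
  moreover have "0 = gradphi lamstar"
    by (rule GDERIV_subgradient_unique[OF phi_grad]) (simp add: \<phi>_min)
  ultimately have "z \<in> {x \<in> Q. A x = b}"
    using z_Q by simp
  then have "primal_value Q f A b \<ge> - \<phi> lamstar"
    unfolding primal_value_def using \<phi>_ge[of _ lamstar]
    by (intro cINF_greatest) force+
  moreover have "f xbar \<le> \<epsilon> / 2 - \<phi> lamstar"
    using gap[of 0] by simp
  moreover have "32 * L * R\<^sup>2 / (real N)\<^sup>2 \<ge> 0"
    using \<open>L > 0\<close> by simp
  ultimately have obj: "f xbar - primal_value Q f A b \<le> 32 * L * R\<^sup>2 / (real N)\<^sup>2 + \<epsilon> / 2"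
    by linarith

  define r where "r = norm (A xbar - b)"
  have "r \<le> 2 * R / C + \<epsilon> / (2 * R)"
  proof -
    \<comment> \<open>The linear term becomes \<open>- 2 * R * r\<close>, of which weak duality
      gives back at most \<open>R * r\<close>. If \<open>r = 0\<close>, division by zero makes
      \<open>u\<close> zero. As \<open>xbar\<close> is a mean, \<open>u\<close> is deterministic, as
      \<open>gap\<close> requires.\<close>
    define u where "u = (2 * R / r) *\<^sub>R (A xbar - b)"
    have r0: "r * r = (A xbar - b) \<bullet> (A xbar - b)"
      unfolding r_def by (simp add: power2_norm_eq_inner[symmetric] power2_eq_square)
    have "(b - A xbar) \<bullet> u = - (2 * R / r) * (r * r)"
      unfolding u_def r0 by (simp add: inner_diff algebra_simps)
    then have bu: "(b - A xbar) \<bullet> u = - 2 * R * r"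
      by (cases "r = 0") auto
    have "norm u = \<bar>2 * R / r\<bar> * r"
      unfolding u_def r_def by simp
    then have "norm u \<le> 2 * R"
      using \<open>R > 0\<close> by (cases "r = 0") (auto simp: r_def)
    then have "(norm u)\<^sup>2 \<le> (2 * R)\<^sup>2"
      by (intro power_mono) auto
    then have nu: "(norm u)\<^sup>2 / (2 * C) \<le> (2 * R)\<^sup>2 / (2 * C)"
      using C_pos by (intro divide_right_mono) auto
    have "lamstar \<bullet> (A xbar - b) \<le> R * r"
      using norm_cauchy_schwarz[of lamstar "A xbar - b"]
        mult_right_mono[OF \<open>norm lamstar \<le> R\<close>, of r] unfolding r_def by simp
    then have "- (R * r) \<le> \<phi> lamstar + f xbar"
      using \<phi>_ge[OF xbar_Q, of lamstar] by (simp add: inner_diff_right)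
    then have "R * r \<le> (2 * R)\<^sup>2 / (2 * C) + \<epsilon> / 2"
      using gap[of u] bu nu by linarith
    also have "\<dots> = R * (2 * R / C + \<epsilon> / (2 * R))"
      using C_pos \<open>R > 0\<close> by (simp add: field_simps power2_eq_square)
    finally show ?thesis
      using \<open>R > 0\<close> by simp
  qed
  \<comment> \<open>The growth of \<open>C\<close> bounds this term by
    \<open>16 * L * R / (real N)\<^sup>2\<close>, which lies within the claimed constant.\<close>
  also have "2 * R / C \<le> 2 * R / ((real N)\<^sup>2 / (8 * L))"
    using C \<open>R > 0\<close> \<open>L > 0\<close> \<open>N \<ge> 1\<close> by (intro divide_left_mono mult_pos_pos C_pos) auto
  also have "2 * R / ((real N)\<^sup>2 / (8 * L)) \<le> 32 * L * R / (real N)\<^sup>2"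
    using \<open>R > 0\<close> \<open>L > 0\<close> by (simp add: divide_right_mono)
  finally have "r \<le> 32 * L * R / (real N)\<^sup>2 + \<epsilon> / (2 * R)"
    by simp
  with obj show ?thesis
    by (simp add: xbar_def r_def)
qed

end
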